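(* Let $d\ge 1$, $\alpha\in(0,2)$ and $0<\kappa_0\le\kappa_1<\infty$. There is a constant $c=c(d,\alpha,\kappa_0,\kappa_1)>0$ such that for any two measurable functions $\kappa,\tilde\kappa:\mathbb{R}^d\to\mathbb{R}$ that are symmetric (i.e. $\kappa(z)=\kappa(-z)$, $\tilde\kappa(z)=\tilde\kappa(-z)$ for all $z$) and satisfy $\kappa_0\le\kappa(z)\le\kappa_1$ and $\kappa_0\le\tilde\kappa(z)\le\kappa_1$ for all $z\in\mathbb{R}^d$, $$\left|p^{\kappa}_\alpha(t,x)-p^{\tilde\kappa}_\alpha(t,x)\right|\le c\,\|\kappa-\tilde\kappa\|_\infty\,\frac{t}{(t^{1/\alpha}+|x|)^{d+\alpha}}\qquad\text{for all } t\in(0,1],\ x\in\mathbb{R}^d,$$ where $\|\kappa-\tilde\kappa\|_\infty:=\sup_{z\in\mathbb{R}^d}|\kappa(z)-\tilde\kappa(z)|$.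
   Context: For a symmetric measurable function $\kappa$ on $\mathbb{R}^d$ bounded between two positive constants, $p^\kappa_\alpha(t,\cdot)$ denotes the (continuous) probability density at time $t>0$ of the symmetric pure jump Lévy process on $\mathbb{R}^d$ starting from $0$ with Lévy measure $\frac{\kappa(z)}{|z|^{d+\alpha}}\,dz$ (no Gaussian part, no drift); that is, $$p^\kappa_\alpha(t,x)=(2\pi)^{-d}\int_{\mathbb{R}^d}e^{-ix\cdot\xi}e^{-t\psi_\kappa(\xi)}\,d\xi,\qquad \psi_\kappa(\xi)=\int_{\mathbb{R}^d}(1-\cos(\xi\cdot z))\frac{\kappa(z)}{|z|^{d+\alpha}}\,dz .$$ *)

theory Defs
  imports "HOL-Analysis.Analysis"
begin

text \<open>
  The space \<open>\<real>\<^sup>d\<close> is a type of class \<open>euclidean_space\<close> and \<open>d = DIM('a)\<close>, which is at least 1.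
  Integrals are over \<^term>\<open>lebesgue\<close> because the kernels \<open>\<kappa>\<close> may be merely Lebesgue measurable.
  At the origin \<open>levy_density\<close> is 0 by the convention for division by 0; this concerns a null set.
\<close>

definition levy_density :: "real \<Rightarrow> ('a::euclidean_space \<Rightarrow> real) \<Rightarrow> 'a \<Rightarrow> real" where
  "levy_density \<alpha> \<kappa> z = \<kappa> z / norm z powr (real DIM('a) + \<alpha>)"

definition levy_symbol :: "real \<Rightarrow> ('a::euclidean_space \<Rightarrow> real) \<Rightarrow> 'a \<Rightarrow> real" where
  "levy_symbol \<alpha> \<kappa> \<xi> = (LINT z|lebesgue. (1 - cos (\<xi> \<bullet> z)) * levy_density \<alpha> \<kappa> z)"

text \<open>
  The density is given by the Fourier inversion formula and is therefore of type \<^typ>\<open>complex\<close>.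
  Its values are real, since \<open>levy_symbol \<alpha> \<kappa>\<close> is an even function.
\<close>

definition heat_kernel ::
  "real \<Rightarrow> ('a::euclidean_space \<Rightarrow> real) \<Rightarrow> real \<Rightarrow> 'a \<Rightarrow> complex" where
  "heat_kernel \<alpha> \<kappa> t x =
     complex_of_real (1 / (2 * pi) ^ DIM('a)) *
     (LINT \<xi>|lebesgue. exp (- \<i> * complex_of_real (x \<bullet> \<xi>)) *
        complex_of_real (exp (- t * levy_symbol \<alpha> \<kappa> \<xi>)))"

text \<open>
  The supremum over all points, not the essential supremum.
\<close>

definition sup_norm :: "('a \<Rightarrow> real) \<Rightarrow> real" where
  "sup_norm f = (SUP z. \<bar>f z\<bar>)"

definition admissible_kernel ::
  "real \<Rightarrow> real \<Rightarrow> ('a::euclidean_space \<Rightarrow> real) \<Rightarrow> bool" where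
  "admissible_kernel \<kappa>\<^sub>0 \<kappa>\<^sub>1 \<kappa> \<longleftrightarrow>
     \<kappa> \<in> borel_measurable lebesgue \<and>
     (\<forall>z. \<kappa> (- z) = \<kappa> z) \<and>
     (\<forall>z. \<kappa>\<^sub>0 \<le> \<kappa> z \<and> \<kappa> z \<le> \<kappa>\<^sub>1)"

end

theory Submission
  imports Defs "HOL-Complex_Analysis.Conformal_Mappings"
begin

text \<open>
  Why the estimate holds. Replacing \<open>\<kappa>\<close> by its dilation by \<open>t powr (1 / \<alpha>)\<close> reduces the claim to time 1
  (\<open>heat_kernel_scaling\<close>), where the bound to be shown is a multiple of the weight
  \<open>w x = (1 + norm x) powr - (d + \<alpha>)\<close>.

  At time 1 the jumps are split at size one. The jumps larger than one have a density bounded by a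
  multiple of \<open>w\<close>, and \<open>w\<close> convolved with itself is at most a multiple of \<open>w\<close>
  (\<open>tail_weight_convolution\<close>): a large sum of two jumps comes from one large jump. Functions dominated by
  \<open>w\<close> therefore form an algebra under convolution, and the compound Poisson factor of the large jumps,
  an exponential series, acts on it with an explicit bound
  (\<open>fourier_exp_jump_symbol_minus_one_bound\<close>).

  The jumps of size at most one have a symbol that extends to complex frequencies, with real part at
  least a multiple of \<open>norm \<xi> powr \<alpha>\<close> up to a constant (\<open>tilted_small_part_decay\<close>). Shifting the
  frequency into the complex domain in the direction of \<open>x\<close> shows that their density decays
  exponentially, hence is dominated by \<open>w\<close> (\<open>fourier_analytic_shift_bound\<close>, \<open>small_kernel_bounds\<close>).

  Both factors depend on \<open>\<kappa>\<close> in a Lipschitz way for the norm given by \<open>w\<close>. For the large jumps the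
  difference enters through the exponential series; for the small jumps through the difference of two
  exponentials of symbols, where a quadratic factor in \<open>\<xi>\<close> is absorbed by the decay. The product rule
  for differences combines them (\<open>unit_time_bound\<close>).
\<close>

section \<open>Integration with respect to Lebesgue measure\<close>

text \<open>
  Kernels are only Lebesgue measurable, so Fubini is applied to products of completed measures;
  the completion inherits a countable cover by sets of finite measure.
\<close>

lemma sigma_finite_lebesgue: "sigma_finite_measure (lebesgue :: 'a::euclidean_space measure)"
proof
  obtain A :: "'a set set" where A: "countable A" "A \<subseteq> sets lborel" "\<Union>A = space lborel"
    "\<forall>a\<in>A. emeasure lborel a \<noteq> \<infinity>"
    using lborel.sigma_finite_countable by blast
  have "\<forall>a\<in>A. emeasure lebesgue a \<noteq> \<infinity>"
    using A by (auto simp: subset_iff)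
  then show "\<exists>A. countable A \<and> A \<subseteq> sets (lebesgue :: 'a measure) \<and> \<Union>A = space lebesgue \<and> 
     (\<forall>a\<in>A. emeasure lebesgue a \<noteq> \<infinity>)"
    using A by (intro exI[of _ A]) auto
qed

interpretation lebesgue: sigma_finite_measure "lebesgue :: 'a::euclidean_space measure"
  by (rule sigma_finite_lebesgue)

interpretation lebesgue_pair: pair_sigma_finite
  "lebesgue :: 'a::euclidean_space measure" "lebesgue :: 'b::euclidean_space measure"
  by (intro pair_sigma_finite.intro sigma_finite_lebesgue)

lemma id_measurable_lebesgue_borel [measurable]: "(\<lambda>x. x) \<in> lebesgue \<rightarrow>\<^sub>M borel"
  by (rule measurable_completion) simp

lemma cball_measurable_lebesgue [measurable]: "cball (c::'a::euclidean_space) r \<in> sets lebesgue"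
  by simp

lemma lebesgue_integral_affine:
  fixes f :: "'a::euclidean_space \<Rightarrow> 'b::{banach, second_countable_topology}"
  assumes f [measurable]: "f \<in> borel_measurable lebesgue" and c: "c \<noteq> 0"
  shows "(LINT x|lebesgue. f (a + c *\<^sub>R x)) = (1 / \<bar>c\<bar> ^ DIM('a)) *\<^sub>R (LINT x|lebesgue. f x)"
proof -
  let ?T = "\<lambda>x::'a. a + (\<Sum>j\<in>Basis. (c * (x \<bullet> j)) *\<^sub>R j)"
  have T: "?T x = a + c *\<^sub>R x" for x
    by (simp add: euclidean_representation flip: scaleR_scaleR scaleR_sum_right)
  have leb: "lebesgue = density (distr lebesgue lebesgue ?T) (\<lambda>_. \<Prod>j\<in>(Basis::'a set). \<bar>c\<bar>)"
    by (rule lebesgue_affine_euclidean) (use c in auto)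
  have [measurable]: "?T \<in> lebesgue \<rightarrow>\<^sub>M lebesgue"
    by (rule lebesgue_affine_measurable) (use c in auto)
  have "(LINT x|lebesgue. f x) = 
     (LINT x|density (distr lebesgue lebesgue ?T) (\<lambda>_. \<Prod>j\<in>(Basis::'a set). \<bar>c\<bar>). f x)"
    using leb by simp
  also have "\<dots> = (LINT x|density (distr lebesgue lebesgue ?T) (\<lambda>_. ennreal (\<bar>c\<bar> ^ DIM('a))). f x)"
    by (simp add: ennreal_power)
  also have "\<dots> = (LINT x|distr lebesgue lebesgue ?T. (\<bar>c\<bar> ^ DIM('a)) *\<^sub>R f x)"
    by (subst integral_density) auto
  also have "\<dots> = (LINT x|lebesgue. (\<bar>c\<bar> ^ DIM('a)) *\<^sub>R f (?T x))"
    by (subst integral_distr) auto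
  finally show ?thesis
    using c by (simp add: T)
qed

lemma integrable_lebesgue_affine:
  fixes f :: "'a::euclidean_space \<Rightarrow> 'b::{banach, second_countable_topology}"
  assumes f: "integrable lebesgue f" and c: "c \<noteq> 0"
  shows "integrable lebesgue (\<lambda>x. f (a + c *\<^sub>R x))"
proof -
  let ?T = "\<lambda>x::'a. a + (\<Sum>j\<in>Basis. (c * (x \<bullet> j)) *\<^sub>R j)"
  have T: "?T x = a + c *\<^sub>R x" for x
    by (simp add: euclidean_representation flip: scaleR_scaleR scaleR_sum_right)
  have [measurable]: "f \<in> borel_measurable lebesgue" using f by auto
  have leb: "lebesgue = density (distr lebesgue lebesgue ?T) (\<lambda>_. \<Prod>j\<in>(Basis::'a set). \<bar>c\<bar>)"
    by (rule lebesgue_affine_euclidean) (use c in auto)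
  have [measurable]: "?T \<in> lebesgue \<rightarrow>\<^sub>M lebesgue"
    by (rule lebesgue_affine_measurable) (use c in auto)
  have "integrable (density (distr lebesgue lebesgue ?T) (\<lambda>_. ennreal (\<bar>c\<bar> ^ DIM('a)))) f"
    using f by (subst (asm) leb) (simp add: ennreal_power)
  then have "integrable lebesgue (\<lambda>x. (\<bar>c\<bar> ^ DIM('a)) *\<^sub>R f (?T x))"
    by (subst (asm) integrable_density) (auto simp: integrable_distr_eq)
  then have "integrable lebesgue (\<lambda>x. (1 / \<bar>c\<bar> ^ DIM('a)) *\<^sub>R ((\<bar>c\<bar> ^ DIM('a)) *\<^sub>R f (?T x)))"
    by (rule integrable_scaleR_right)
  then show ?thesis
    using c by (simp add: T)
qed

lemma integrable_dominated:
  fixes f :: "'a \<Rightarrow> 'b::{banach, second_countable_topology}"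
  assumes g: "integrable M g" and [measurable]: "f \<in> borel_measurable M"
    and le: "\<And>x. norm (f x) \<le> g x"
  shows "integrable M f"
  using g by (rule Bochner_Integration.integrable_bound)
    (auto intro!: AE_I2 intro: order.trans[OF le abs_ge_self])

lemma integral_norm_bound_dominated:
  fixes f :: "'a \<Rightarrow> 'b::{banach, second_countable_topology}"
  assumes g: "integrable M g" and le: "\<And>x. norm (f x) \<le> g x"
  shows "norm (LINT x|M. f x) \<le> (LINT x|M. g x)"
proof (cases "integrable M f")
  case True
  have "norm (LINT x|M. f x) \<le> (LINT x|M. norm (f x))" by (rule integral_norm_bound)
  also have "\<dots> \<le> (LINT x|M. g x)"
    using True g le by (intro integral_mono) auto
  finally show ?thesis .
next
  case False
  have "0 \<le> g x" for x using le[of x] norm_ge_zero order_trans by blast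
  then show ?thesis
    using False by (simp add: not_integrable_integral_eq)
qed

text \<open>
  A bound on an open set controls the derivative on a smaller disc (Cauchy's inequality), so the
  difference quotients inherit an integrable majorant and the derivative passes under the integral.
\<close>

lemma holomorphic_on_parametric_integral:
  fixes f :: "complex \<Rightarrow> 'a \<Rightarrow> complex"
  assumes S: "open S"
    and hol: "\<And>w. (\<lambda>s. f s w) holomorphic_on S"
    and meas: "\<And>s. s \<in> S \<Longrightarrow> f s \<in> borel_measurable M"
    and bound: "\<And>s w. s \<in> S \<Longrightarrow> cmod (f s w) \<le> g w"
    and g: "integrable M g"
  shows "(\<lambda>s. LINT w|M. f s w) holomorphic_on S"
proof -
  have int: "integrable M (f s)" if "s \<in> S" for s
    using g meas[OF that] by (rule Bochner_Integration.integrable_bound)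
      (use bound[OF that] in \<open>auto intro!: AE_I2 order.trans[OF bound[OF that]]\<close>)
  have "\<exists>d. ((\<lambda>s. LINT w|M. f s w) has_field_derivative d) (at s0)" if s0: "s0 \<in> S" for s0
  proof -
    obtain r where r: "r > 0" "cball s0 (2 * r) \<subseteq> S"
    proof -
      obtain e where "e > 0" "cball s0 e \<subseteq> S"
        using open_contains_cball_eq[OF S] s0 by blast
      then show ?thesis using that[of "e/2"] by simp
    qed
    let ?B = "ball s0 r"
    have BS: "?B \<subseteq> S" using r by auto
    have g0: "g w \<ge> 0" for w using bound[OF s0, of w] norm_ge_zero order_trans by blast
    have der: "((\<lambda>s. f s w) has_field_derivative deriv (\<lambda>s. f s w) s) (at s)" if "s \<in> S" for s w
      using hol S that holomorphic_derivI by blast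
    have dbound: "cmod (deriv (\<lambda>s. f s w) s) \<le> g w / r" if s: "s \<in> ?B" for s w
    proof -
      have sub: "cball s r \<subseteq> S"
      proof
        fix u assume "u \<in> cball s r"
        then have "dist s0 u \<le> 2 * r" using s dist_triangle[of s0 u s] by auto
        then show "u \<in> S" using r by auto
      qed
      have "norm ((deriv ^^ 1) (\<lambda>s. f s w) s) \<le> fact 1 * g w / r ^ 1"
      proof (rule Cauchy_inequality)
        show "(\<lambda>s. f s w) holomorphic_on ball s r"
          using hol holomorphic_on_subset sub ball_subset_cball by blast
        show "continuous_on (cball s r) (\<lambda>s. f s w)"
          using hol holomorphic_on_imp_continuous_on continuous_on_subset sub by blast
        show "cmod (f x w) \<le> g w" if "cmod (s - x) = r" for x
          using that sub by (intro bound) (auto simp: dist_norm)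
      qed (use r in auto)
      then show ?thesis by simp
    qed
    have lip: "cmod (f s w - f s0 w) \<le> g w / r * cmod (s - s0)" if s: "s \<in> ?B" for s w
    proof (rule field_differentiable_bound[of ?B])
      show "((\<lambda>s. f s w) has_field_derivative deriv (\<lambda>s. f s w) u) (at u within ?B)" if "u \<in> ?B" for u
        using der[of u w] that BS has_field_derivative_at_within by blast
    qed (use s r dbound in auto)
    define D where "D w = deriv (\<lambda>s. f s w) s0" for w
    have "((\<lambda>s. ((LINT w|M. f s w) - (LINT w|M. f s0 w)) / (s - s0)) \<longlongrightarrow> (LINT w|M. D w)) (at s0 within ?B)"
      unfolding tendsto_at_iff_sequentially comp_def
    proof (intro allI impI)
      fix X assume X: "\<forall>i. X i \<in> ?B - {s0}" and lim: "X \<longlonglongrightarrow> s0"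
      have XS: "X i \<in> S" for i using X BS by auto
      have conv: "(\<lambda>i. (f (X i) w - f s0 w) / (X i - s0)) \<longlonglongrightarrow> D w" for w
      proof -
        have "((\<lambda>s. (f s w - f s0 w) / (s - s0)) \<longlongrightarrow> D w) (at s0 within UNIV)"
          using der[OF s0, of w] unfolding has_field_derivative_iff D_def .
        then show ?thesis
          unfolding tendsto_at_iff_sequentially comp_def using X lim by auto
      qed
      have mq: "(\<lambda>w. (f (X i) w - f s0 w) / (X i - s0)) \<in> borel_measurable M" for i
        using meas[OF XS[of i]] meas[OF s0] by measurable
      have "(\<lambda>i. LINT w|M. (f (X i) w - f s0 w) / (X i - s0)) \<longlonglongrightarrow> (LINT w|M. D w)"
      proof (rule integral_dominated_convergence)
        show "D \<in> borel_measurable M"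
          by (rule borel_measurable_LIMSEQ_metric[OF mq]) (rule conv)
        show "integrable M (\<lambda>w. g w / r)" using g by simp
        show "AE w in M. cmod ((f (X i) w - f s0 w) / (X i - s0)) \<le> g w / r" for i
        proof (rule AE_I2)
          fix w
          have "cmod (X i - s0) > 0" using X by auto
          then show "cmod ((f (X i) w - f s0 w) / (X i - s0)) \<le> g w / r"
            using lip[of "X i" w] X by (simp add: norm_divide pos_divide_le_eq)
        qed
      qed (use mq conv in auto)
      moreover have "(LINT w|M. (f (X i) w - f s0 w) / (X i - s0)) =
        ((LINT w|M. f (X i) w) - (LINT w|M. f s0 w)) / (X i - s0)" for i
        using int[OF XS[of i]] int[OF s0]
        by (simp only: integral_divide_zero Bochner_Integration.integral_diff)
      ultimately show "(\<lambda>i. ((LINT w|M. f (X i) w) - (LINT w|M. f s0 w)) / (X i - s0)) \<longlonglongrightarrow> (LINT w|M. D w)"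
        by (simp only:)
    qed
    then have "((\<lambda>s. LINT w|M. f s w) has_field_derivative (LINT w|M. D w)) (at s0 within ?B)"
      unfolding has_field_derivative_iff .
    then show ?thesis
      using r by (auto simp: at_within_open[of s0 ?B])
  qed
  then show ?thesis
    by (auto simp: holomorphic_on_def field_differentiable_def intro: has_field_derivative_at_within)
qed

text \<open>
  A substitute for polar coordinates: the function is at most the sum of \<open>b k\<close> times the indicators of
  the balls, and the sum of the integrals of these is finite. Below, the balls are dyadic.
\<close>

lemma integrable_lebesgue_by_balls:
  fixes f :: "'a::euclidean_space \<Rightarrow> real"
  assumes f [measurable]: "f \<in> borel_measurable lebesgue"
    and cover: "\<And>z. f z \<noteq> 0 \<Longrightarrow> \<exists>k::nat. norm z \<le> r k \<and> \<bar>f z\<bar> \<le> b k"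
    and nonneg: "\<And>k. 0 \<le> r k" "\<And>k. 0 \<le> b k"
    and summable: "summable (\<lambda>k. b k * r k ^ DIM('a))"
  shows "integrable lebesgue f"
proof (rule integrableI_bounded)
  have "(\<integral>\<^sup>+ z. ennreal (norm (f z)) \<partial>lebesgue) \<le> 
        (\<integral>\<^sup>+ z. (\<Sum>k. ennreal (b k) * indicator (cball 0 (r k)) (z::'a)) \<partial>lebesgue)"
  proof (rule nn_integral_mono)
    fix z :: 'a
    show "ennreal (norm (f z)) \<le> (\<Sum>k. ennreal (b k) * indicator (cball 0 (r k)) z)"
    proof (cases "f z = 0")
      case False
      then obtain k where k: "norm z \<le> r k" "\<bar>f z\<bar> \<le> b k" using cover by blast
      have "ennreal (norm (f z)) \<le> ennreal (b k) * indicator (cball 0 (r k)) z"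
        using k by (simp add: ennreal_leI)
      also have "\<dots> \<le> (\<Sum>k. ennreal (b k) * indicator (cball 0 (r k)) z)"
      proof -
        have "g k \<le> (\<Sum>k. g k)" for g :: "nat \<Rightarrow> ennreal"
          using sum_le_suminf[of g "{k}"] by simp
        then show ?thesis .
      qed
      finally show ?thesis .
    qed simp
  qed
  also have "\<dots> = (\<Sum>k. \<integral>\<^sup>+ z. ennreal (b k) * indicator (cball 0 (r k)) (z::'a) \<partial>lebesgue)"
    by (rule nn_integral_suminf) measurable
  also have "\<dots> = (\<Sum>k. ennreal (unit_ball_vol DIM('a) * (b k * r k ^ DIM('a))))"
  proof (rule suminf_cong)
    fix k
    have "(\<integral>\<^sup>+ z. ennreal (b k) * indicator (cball 0 (r k)) (z::'a) \<partial>lebesgue)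
        = ennreal (b k) * emeasure lebesgue (cball (0::'a) (r k))"
      by (rule nn_integral_cmult_indicator) simp
    also have "emeasure lebesgue (cball (0::'a) (r k)) = ennreal (unit_ball_vol DIM('a) * r k ^ DIM('a))"
      using nonneg(1)[of k] by (simp add: emeasure_cball)
    also have "ennreal (b k) * ennreal (unit_ball_vol DIM('a) * r k ^ DIM('a)) =
        ennreal (b k * (unit_ball_vol DIM('a) * r k ^ DIM('a)))"
      by (rule ennreal_mult'[symmetric]) (rule nonneg)
    also have "b k * (unit_ball_vol DIM('a) * r k ^ DIM('a)) = unit_ball_vol DIM('a) * (b k * r k ^ DIM('a))"
      by (rule mult.left_commute)
    finally show "(\<integral>\<^sup>+ z. ennreal (b k) * indicator (cball 0 (r k)) (z::'a) \<partial>lebesgue)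
        = ennreal (unit_ball_vol DIM('a) * (b k * r k ^ DIM('a)))" .
  qed
  also have "\<dots> = ennreal (\<Sum>k. unit_ball_vol DIM('a) * (b k * r k ^ DIM('a)))"
    by (rule suminf_ennreal2) (intro mult_nonneg_nonneg nonneg zero_le_power unit_ball_vol_nonneg,
      simp, rule summable_mult[OF summable])
  also have "\<dots> < \<infinity>"
    by simp
  finally show "(\<integral>\<^sup>+ z. ennreal (norm (f z)) \<partial>lebesgue) < \<infinity>" .
qed simp

section \<open>The weight of the tail and its convolution\<close>

definition tail_weight :: "real \<Rightarrow> 'a::euclidean_space \<Rightarrow> real" where
  "tail_weight a x = (1 + norm x) powr - (real DIM('a) + a)"

lemma tail_weight_measurable [measurable]: 
  "tail_weight a \<in> borel_measurable (lebesgue :: 'a::euclidean_space measure)"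
  unfolding tail_weight_def by measurable

lemma tail_weight_pos: "tail_weight a x > 0"
proof -
  have "1 + norm x \<noteq> 0"
    using norm_ge_zero[of x] by linarith
  then show ?thesis
    by (simp add: tail_weight_def)
qed

lemma tail_weight_nonneg [simp]: "0 \<le> tail_weight a x"
  using tail_weight_pos[of a x] by simp

lemma tail_weight_minus [simp]: "tail_weight a (- x) = tail_weight a x"
  by (simp add: tail_weight_def)

lemma powr_two_minus_geometric: "(2 powr (-a)) ^ k = 2 powr (- a * real k)"
  by (simp add: powr_powr flip: powr_realpow)

lemma integrable_tail_weight:
  assumes "0 < a"
  shows "integrable (lebesgue :: 'a::euclidean_space measure) (tail_weight a)"
proof (rule integrable_lebesgue_by_balls)
  let ?p = "real DIM('a) + a"
  \<comment> \<open>A point uses the ball of its shell \<open>2 ^ k \<le> 1 + norm z \<le> 2 ^ (k + 1)\<close>.\<close>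
  let ?r = "\<lambda>k::nat. 2 powr real (Suc k)"
  let ?b = "\<lambda>k::nat. (2 powr real k) powr - ?p"
  show "\<exists>k. norm z \<le> ?r k \<and> \<bar>tail_weight a z\<bar> \<le> ?b k" for z :: 'a
  proof -
    define y where "y = log 2 (1 + norm z)"
    define k where "k = nat \<lfloor>y\<rfloor>"
    have y: "2 powr y = 1 + norm z" "y \<ge> 0"
      by (auto simp: y_def add_pos_nonneg)
    have k: "real k \<le> y" "y \<le> real (Suc k)" using y by (auto simp: k_def) linarith
    have "1 + norm z \<le> ?r k" using k(2) unfolding y(1)[symmetric] by simp
    moreover have "tail_weight a z \<le> ?b k"
      unfolding tail_weight_def y(1)[symmetric] using k(1) assms
      by (intro powr_mono2') auto
    ultimately show ?thesis by (intro exI[of _ k]) auto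
  qed
  have "?b k * ?r k ^ DIM('a) = 2 ^ DIM('a) * (2 powr (-a)) ^ k" for k
    by (simp add: powr_powr powr_two_minus_geometric algebra_simps flip: powr_realpow powr_add)
  then show "summable (\<lambda>k. ?b k * ?r k ^ DIM('a))"
    using assms by (simp add: summable_geometric powr_less_one)
qed (auto simp: tail_weight_measurable)

lemma integrable_small_jumps:
  assumes "0 < \<alpha>" "\<alpha> < 2"
  shows "integrable (lebesgue :: 'a::euclidean_space measure)
    (\<lambda>z. (norm z)\<^sup>2 / norm z powr (real DIM('a) + \<alpha>) * indicator (cball 0 1) z)"
proof (rule integrable_lebesgue_by_balls)
  let ?p = "real DIM('a) + \<alpha>"
  \<comment> \<open>A point uses the ball of its shell \<open>2 powr - (k + 1) \<le> norm z \<le> 2 powr - k\<close>.\<close>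
  let ?r = "\<lambda>k::nat. 2 powr - real k"
  let ?b = "\<lambda>k::nat. (2 powr - real k)\<^sup>2 / (2 powr - real (Suc k)) powr ?p"
  show "\<exists>k. norm z \<le> ?r k \<and> \<bar>(norm z)\<^sup>2 / norm z powr ?p * indicator (cball 0 1) z\<bar> \<le> ?b k"
    if z: "(norm z)\<^sup>2 / norm z powr ?p * indicator (cball 0 1) z \<noteq> 0" for z :: 'a
  proof -
    have z: "z \<noteq> 0" "norm z \<le> 1" using z by (auto simp: indicator_def split: if_splits)
    define y where "y = - log 2 (norm z)"
    define k where "k = nat \<lfloor>y\<rfloor>"
    have y: "2 powr - y = norm z" "y \<ge> 0"
      using z by (auto simp: y_def)
    have k: "real k \<le> y" "y \<le> real (Suc k)" using y by (auto simp: k_def) linarith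
    have *: "norm z \<le> ?r k" "2 powr - real (Suc k) \<le> norm z"
      using k unfolding y(1)[symmetric] by auto
    have "(norm z)\<^sup>2 / norm z powr ?p \<le> ?b k"
      using * assms z by (intro frac_le power_mono powr_mono2) auto
    then show ?thesis using * z by (intro exI[of _ k]) auto
  qed
  have "?b k * ?r k ^ DIM('a) = 2 powr ?p * (2 powr (-(2-\<alpha>))) ^ k" for k
    by (simp add: powr_powr powr_two_minus_geometric algebra_simps power2_eq_square powr_divide divide_inverse
       flip: powr_realpow powr_add powr_minus)
  then show "summable (\<lambda>k. ?b k * ?r k ^ DIM('a))"
    using assms by (simp add: summable_geometric powr_less_one)
next
  show "(\<lambda>z. (norm z)\<^sup>2 / norm z powr (real DIM('a) + \<alpha>) * indicator (cball (0::'a) 1) z) \<in> borel_measurable lebesgue"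
    by measurable
qed auto

lemma tail_weight_le_shift:
  fixes x y :: "'a::euclidean_space"
  assumes "0 < a" "1 + norm x \<le> 2 * (1 + norm y)"
  shows "tail_weight a y \<le> 2 powr (real DIM('a) + a) * tail_weight a x"
proof -
  have "((1 + norm x) / 2) powr (real DIM('a) + a) \<le> (1 + norm y) powr (real DIM('a) + a)"
    using assms by (intro powr_mono2) auto
  moreover have "1 + norm x > 0" "1 + norm y > 0"
    using norm_ge_zero[of x] norm_ge_zero[of y] by linarith+
  moreover from this have "(1 + norm x) powr (real DIM('a) + a) > 0" "(1 + norm y) powr (real DIM('a) + a) > 0"
    by (metis powr_gt_zero less_irrefl)+
  ultimately show ?thesis
    unfolding tail_weight_def powr_minus by (simp only: powr_divide) (simp add: divide_simps mult_ac)
qed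

text \<open>
  One of \<open>z\<close> and \<open>x - z\<close> is at least comparable to \<open>x\<close> in size, and the weight of that one is then
  comparable to the weight of \<open>x\<close>. This is the single big jump principle that makes the functions
  dominated by the weight an algebra under convolution.
\<close>

lemma tail_weight_mult_le:
  fixes x z :: "'a::euclidean_space"
  assumes "0 < a"
  shows "tail_weight a z * tail_weight a (x - z) \<le>
    2 powr (real DIM('a) + a) * tail_weight a x * (tail_weight a z + tail_weight a (x - z))"
proof -
  have n: "norm x \<le> norm z + norm (x - z)" by norm
  let ?c = "2 powr (real DIM('a) + a) * tail_weight a x"
  have c: "?c \<ge> 0" by simp
  consider "1 + norm x \<le> 2 * (1 + norm z)" | "1 + norm x \<le> 2 * (1 + norm (x - z))"
    using n by fastforce
  then show ?thesis
  proof cases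
    case 1
    have "tail_weight a z * tail_weight a (x - z) \<le> ?c * tail_weight a (x - z)"
      using tail_weight_le_shift[OF assms 1] by (rule mult_right_mono) simp
    then show ?thesis using c by (simp add: distrib_left add_increasing)
  next
    case 2
    have "tail_weight a z * tail_weight a (x - z) \<le> tail_weight a z * ?c"
      using tail_weight_le_shift[OF assms 2] by (rule mult_left_mono) simp
    also have "\<dots> = ?c * tail_weight a z" by (rule mult.commute)
    finally show ?thesis using c by (simp add: distrib_left add_increasing2)
  qed
qed

definition tail_mass :: "'a::euclidean_space itself \<Rightarrow> real \<Rightarrow> real" where
  "tail_mass _ a = (LINT z|lebesgue. tail_weight a (z :: 'a))"

lemma integrable_tail_weight_reflect:
  fixes x :: "'a::euclidean_space"
  assumes "0 < a"
  shows "integrable lebesgue (\<lambda>z. tail_weight a (x - z))"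
    and "(LINT z|lebesgue. tail_weight a (x - z)) = tail_mass TYPE('a) a"
  using integrable_lebesgue_affine[OF integrable_tail_weight[OF assms], where c="-1" and a=x]
    lebesgue_integral_affine[of "tail_weight a :: 'a \<Rightarrow> real", where c="-1" and a=x]
  by (auto simp: tail_mass_def tail_weight_measurable)

lemma tail_weight_convolution:
  fixes x :: "'a::euclidean_space"
  assumes a: "0 < a"
  shows "integrable lebesgue (\<lambda>z. tail_weight a z * tail_weight a (x - z))"
    and "(LINT z|lebesgue. tail_weight a z * tail_weight a (x - z)) \<le>
     2 powr (real DIM('a) + a) * (2 * tail_mass TYPE('a) a) * tail_weight a x"
proof -
  let ?c = "2 powr (real DIM('a) + a) * tail_weight a x"
  have [measurable]: "(\<lambda>z. tail_weight a (x - z)) \<in> borel_measurable lebesgue"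
    using integrable_tail_weight_reflect(1)[OF a, of x] by auto
  have i: "integrable lebesgue (\<lambda>z. ?c * (tail_weight a z + tail_weight a (x - z)))"
    by (intro integrable_mult_right Bochner_Integration.integrable_add integrable_tail_weight a
        integrable_tail_weight_reflect(1))
  show j: "integrable lebesgue (\<lambda>z. tail_weight a z * tail_weight a (x - z))"
    using i by (rule Bochner_Integration.integrable_bound)
      (use tail_weight_mult_le[OF a] in \<open>auto intro!: AE_I2 simp: abs_mult\<close>)
  have "(LINT z|lebesgue. tail_weight a z * tail_weight a (x - z)) \<le> 
      (LINT z|lebesgue. ?c * (tail_weight a z + tail_weight a (x - z)))"
    using j i tail_weight_mult_le[OF a] by (intro integral_mono) auto
  also have "\<dots> = ?c * (2 * tail_mass TYPE('a) a)"
    unfolding integral_mult_right_zero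
      Bochner_Integration.integral_add[OF integrable_tail_weight[OF a] integrable_tail_weight_reflect(1)[OF a]]
      integrable_tail_weight_reflect(2)[OF a] tail_mass_def
    by simp
  finally show "(LINT z|lebesgue. tail_weight a z * tail_weight a (x - z)) \<le>
     2 powr (real DIM('a) + a) * (2 * tail_mass TYPE('a) a) * tail_weight a x"
    by (simp add: mult_ac)
qed

section \<open>Fourier integrals and symbols of finite jump measures\<close>

definition fourier :: "('a::euclidean_space \<Rightarrow> complex) \<Rightarrow> 'a \<Rightarrow> complex" where
  "fourier \<Phi> x = (LINT \<xi>|lebesgue. exp (- \<i> * complex_of_real (x \<bullet> \<xi>)) * \<Phi> \<xi>)"

text \<open>
  The characteristic exponent of the symmetrized jump measure with density \<open>m\<close>. It is also used for
  densities of either sign, such as differences of Levy densities.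
\<close>

definition jump_symbol :: "('a::euclidean_space \<Rightarrow> real) \<Rightarrow> 'a \<Rightarrow> real" where
  "jump_symbol m \<xi> = (LINT z|lebesgue. (1 - cos (\<xi> \<bullet> z)) * m z)"

lemma norm_fourier_phase [simp]: "cmod (exp (- (\<i> * complex_of_real r))) = 1"
  by (simp add: norm_exp_eq_Re)

lemma integrable_fourier_integrand:
  assumes "integrable lebesgue \<Phi>"
  shows "integrable lebesgue (\<lambda>\<xi>. exp (- \<i> * complex_of_real (x \<bullet> \<xi>)) * \<Phi> \<xi>)"
proof -
  have [measurable]: "\<Phi> \<in> borel_measurable lebesgue" using assms by auto
  show ?thesis
    using integrable_norm[OF assms] by (rule integrable_dominated) (measurable, simp add: norm_mult)
qed

lemma fourier_add:
  assumes "integrable lebesgue \<Phi>" "integrable lebesgue \<Psi>"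
  shows "fourier (\<lambda>\<xi>. \<Phi> \<xi> + \<Psi> \<xi>) x = fourier \<Phi> x + fourier \<Psi> x"
  using integrable_fourier_integrand[OF assms(1), of x] integrable_fourier_integrand[OF assms(2), of x]
  by (simp add: fourier_def distrib_left)

lemma fourier_diff:
  assumes "integrable lebesgue \<Phi>" "integrable lebesgue \<Psi>"
  shows "fourier (\<lambda>\<xi>. \<Phi> \<xi> - \<Psi> \<xi>) x = fourier \<Phi> x - fourier \<Psi> x"
  using integrable_fourier_integrand[OF assms(1), of x] integrable_fourier_integrand[OF assms(2), of x]
  by (simp add: fourier_def right_diff_distrib)

lemma fourier_scale: "fourier (\<lambda>\<xi>. c * \<Phi> \<xi>) x = c * fourier \<Phi> x"
  by (simp add: fourier_def mult.left_commute[of _ c])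

lemma fst_borel_measurable_lebesgue [measurable]:
  "(\<lambda>p. fst p) \<in> (lebesgue :: 'a::euclidean_space measure) \<Otimes>\<^sub>M (lebesgue :: 'b::euclidean_space measure) \<rightarrow>\<^sub>M borel"
  by (rule measurable_compose[OF measurable_fst id_measurable_lebesgue_borel])

lemma snd_borel_measurable_lebesgue [measurable]:
  "(\<lambda>p. snd p) \<in> (lebesgue :: 'a::euclidean_space measure) \<Otimes>\<^sub>M (lebesgue :: 'b::euclidean_space measure) \<rightarrow>\<^sub>M borel"
  by (rule measurable_compose[OF measurable_snd id_measurable_lebesgue_borel])

lemma integrable_tensor_lebesgue:
  fixes \<Phi> :: "'a::euclidean_space \<Rightarrow> complex" and m :: "'b::euclidean_space \<Rightarrow> real"
  assumes \<Phi>: "integrable lebesgue \<Phi>" and m: "integrable lebesgue m"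
  shows "integrable (lebesgue \<Otimes>\<^sub>M lebesgue) (\<lambda>p. \<Phi> (fst p) * complex_of_real (m (snd p)))"
proof (rule lebesgue_pair.Fubini_integrable)
  have [measurable]: "\<Phi> \<in> borel_measurable lebesgue" "m \<in> borel_measurable lebesgue"
    using assms by auto
  show "(\<lambda>p. \<Phi> (fst p) * complex_of_real (m (snd p))) \<in> borel_measurable (lebesgue \<Otimes>\<^sub>M lebesgue)"
    by measurable
  show "integrable lebesgue (\<lambda>x. LINT y|lebesgue. norm (\<Phi> (fst (x, y)) * complex_of_real (m (snd (x, y)))))"
    using \<Phi> by (simp add: norm_mult)
  show "AE x in lebesgue. integrable lebesgue (\<lambda>y. \<Phi> (fst (x, y)) * complex_of_real (m (snd (x, y))))"
    using m by simp
qed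

lemma jump_symbol_measurable [measurable]:
  fixes m :: "'a::euclidean_space \<Rightarrow> real"
  assumes [measurable]: "m \<in> borel_measurable lebesgue"
  shows "jump_symbol m \<in> borel_measurable lebesgue"
  unfolding jump_symbol_def
  by (rule lebesgue.borel_measurable_lebesgue_integral) measurable

lemma one_minus_cos_bounds: "0 \<le> 1 - cos (r::real)" "1 - cos r \<le> 2"
  using cos_ge_minus_one[of r] cos_le_one[of r] by auto

lemma integrable_jump_symbol_integrand:
  fixes m :: "'a::euclidean_space \<Rightarrow> real"
  assumes m: "integrable lebesgue m"
  shows "integrable lebesgue (\<lambda>z. (1 - cos (\<xi> \<bullet> z)) * m z)"
proof -
  have [measurable]: "m \<in> borel_measurable lebesgue" using m by auto
  have "integrable lebesgue (\<lambda>z. 2 * m z)" using m by simp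
  then show ?thesis
    by (rule Bochner_Integration.integrable_bound)
      (measurable, use one_minus_cos_bounds in \<open>auto simp: abs_mult intro!: mult_right_mono\<close>)
qed

lemma abs_jump_symbol_le:
  assumes m: "integrable lebesgue m"
  shows "\<bar>jump_symbol m \<xi>\<bar> \<le> 2 * (LINT z|lebesgue. \<bar>m z\<bar>)"
proof -
  have "\<bar>jump_symbol m \<xi>\<bar> \<le> (LINT z|lebesgue. 2 * \<bar>m z\<bar>)"
    unfolding jump_symbol_def real_norm_def[symmetric]
    by (rule integral_norm_bound_dominated)
      (use one_minus_cos_bounds m in \<open>auto simp: abs_mult intro!: mult_right_mono\<close>)
  then show ?thesis by simp
qed

lemma integrable_mult_jump_symbol:
  assumes \<Phi>: "integrable lebesgue \<Phi>" and m: "integrable lebesgue m"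
  shows "integrable lebesgue (\<lambda>\<xi>. complex_of_real (jump_symbol m \<xi>) * \<Phi> \<xi>)"
proof -
  have [measurable]: "\<Phi> \<in> borel_measurable lebesgue" "m \<in> borel_measurable lebesgue"
    using assms by auto
  have "integrable lebesgue (\<lambda>\<xi>. (2 * (LINT z|lebesgue. \<bar>m z\<bar>)) * cmod (\<Phi> \<xi>))" using \<Phi> by simp
  then show ?thesis
    by (rule Bochner_Integration.integrable_bound)
      (measurable, use abs_jump_symbol_le[OF m] in 
        \<open>auto simp: norm_mult abs_mult intro!: AE_I2 mult_right_mono intro: order.trans[OF _ abs_ge_self]\<close>)
qed

text \<open>
  On the level of densities, multiplication by the symbol is the (negative) generator of the jump
  process: writing the cosine as a mean of two phases turns it into a mean of two translations.
\<close>

lemma fourier_jump_symbol: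
  fixes \<Phi> :: "'a::euclidean_space \<Rightarrow> complex"
  assumes \<Phi>: "integrable lebesgue \<Phi>" and m: "integrable lebesgue m"
  shows "fourier (\<lambda>\<xi>. complex_of_real (jump_symbol m \<xi>) * \<Phi> \<xi>) x =
    (LINT z|lebesgue. (fourier \<Phi> x - (fourier \<Phi> (x - z) + fourier \<Phi> (x + z)) / 2) * complex_of_real (m z))"
proof -
  let ?e = "\<lambda>x \<xi>. exp (- \<i> * complex_of_real (x \<bullet> \<xi>))"
  define f where "f \<xi> z = ?e x \<xi> * \<Phi> \<xi> * complex_of_real ((1 - cos (\<xi> \<bullet> z)) * m z)" for \<xi> z
  have [measurable]: "\<Phi> \<in> borel_measurable lebesgue" "m \<in> borel_measurable lebesgue"
    using assms by auto
  have "integrable (lebesgue \<Otimes>\<^sub>M lebesgue) (\<lambda>p. 2 * cmod (\<Phi> (fst p) * complex_of_real (m (snd p))))"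
    using integrable_tensor_lebesgue[OF assms] by simp
  then have "integrable (lebesgue \<Otimes>\<^sub>M lebesgue) (case_prod f)"
    unfolding f_def split_beta'
  proof (rule Bochner_Integration.integrable_bound)
    show "AE p in lebesgue \<Otimes>\<^sub>M lebesgue. 
      cmod (?e x (fst p) * \<Phi> (fst p) * complex_of_real ((1 - cos (fst p \<bullet> snd p)) * m (snd p))) \<le>
      norm (2 * cmod (\<Phi> (fst p) * complex_of_real (m (snd p))))"
    proof (rule AE_I2)
      fix p :: "'a \<times> 'a"
      have "(1 - cos (fst p \<bullet> snd p)) * (cmod (\<Phi> (fst p)) * \<bar>m (snd p)\<bar>) \<le> 2 * (cmod (\<Phi> (fst p)) * \<bar>m (snd p)\<bar>)"
        using one_minus_cos_bounds by (intro mult_right_mono) auto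
      also have eq: "(1 - cos (fst p \<bullet> snd p)) * (cmod (\<Phi> (fst p)) * \<bar>m (snd p)\<bar>) = cmod (?e x (fst p) * \<Phi> (fst p) * complex_of_real ((1 - cos (fst p \<bullet> snd p)) * m (snd p)))"
        unfolding norm_mult norm_of_real abs_mult 
        using one_minus_cos_bounds(1)[of "fst p \<bullet> snd p"] by simp
      finally show "cmod (?e x (fst p) * \<Phi> (fst p) * complex_of_real ((1 - cos (fst p \<bullet> snd p)) * m (snd p))) \<le>
        norm (2 * cmod (\<Phi> (fst p) * complex_of_real (m (snd p))))"
        by (simp add: norm_mult)
    qed
  qed measurable
  then have "(LINT z|lebesgue. LINT \<xi>|lebesgue. f \<xi> z) = (LINT \<xi>|lebesgue. LINT z|lebesgue. f \<xi> z)"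
    by (rule lebesgue_pair.Fubini_integral)
  moreover have "(LINT z|lebesgue. f \<xi> z) = ?e x \<xi> * (complex_of_real (jump_symbol m \<xi>) * \<Phi> \<xi>)" for \<xi>
  proof -
    have "(LINT z|lebesgue. f \<xi> z) = ?e x \<xi> * \<Phi> \<xi> * (LINT z|lebesgue. complex_of_real ((1 - cos (\<xi> \<bullet> z)) * m z))"
      unfolding f_def by (rule integral_mult_right_zero)
    then show ?thesis
      unfolding integral_complex_of_real jump_symbol_def by (simp only: mult_ac)
  qed
  ultimately have "fourier (\<lambda>\<xi>. complex_of_real (jump_symbol m \<xi>) * \<Phi> \<xi>) x = (LINT z|lebesgue. LINT \<xi>|lebesgue. f \<xi> z)"
    by (simp add: fourier_def)
  moreover have "(LINT \<xi>|lebesgue. f \<xi> z) = 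
     (fourier \<Phi> x - (fourier \<Phi> (x - z) + fourier \<Phi> (x + z)) / 2) * complex_of_real (m z)" for z
  proof -
    have "f \<xi> z = (?e x \<xi> * \<Phi> \<xi> - (?e (x - z) \<xi> * \<Phi> \<xi> + ?e (x + z) \<xi> * \<Phi> \<xi>) / 2) * complex_of_real (m z)" for \<xi>
    proof -
      have c: "complex_of_real (cos (\<xi> \<bullet> z)) = (exp (\<i> * complex_of_real (z \<bullet> \<xi>)) + exp (- \<i> * complex_of_real (z \<bullet> \<xi>))) / 2"
        unfolding cos_of_real[symmetric] by (simp add: cos_exp_eq inner_commute)
      have e: "?e (x - z) \<xi> = ?e x \<xi> * exp (\<i> * complex_of_real (z \<bullet> \<xi>))"
        "?e (x + z) \<xi> = ?e x \<xi> * exp (- \<i> * complex_of_real (z \<bullet> \<xi>))"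
        by (simp_all add: algebra_simps flip: exp_add)
      show ?thesis
        unfolding f_def e of_real_mult of_real_diff c by (simp add: field_simps)
    qed
    then show ?thesis
      using integrable_fourier_integrand[OF \<Phi>, of x] integrable_fourier_integrand[OF \<Phi>, of "x-z"]
        integrable_fourier_integrand[OF \<Phi>, of "x+z"]
      by (simp add: fourier_def)
  qed
  ultimately show ?thesis by simp
qed

text \<open>
  The factor by which convolution with the weight, together with the killing term of the generator,
  can increase the size of a function relative to the weight.
\<close>

definition jump_const :: "'a::euclidean_space itself \<Rightarrow> real \<Rightarrow> real" where
  "jump_const _ a = tail_mass TYPE('a) a * (1 + 2 * 2 powr (real DIM('a) + a))"

lemma jump_const_nonneg: "0 \<le> jump_const TYPE('a::euclidean_space) a"
  unfolding jump_const_def tail_mass_def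
  by (intro mult_nonneg_nonneg Bochner_Integration.integral_nonneg) auto

text \<open>
  The generator of a jump process whose jump density is dominated by the weight preserves domination
  by the weight. The translates are handled by the convolution inequality.
\<close>

lemma fourier_jump_symbol_bound:
  fixes \<Phi> :: "'a::euclidean_space \<Rightarrow> complex"
  assumes a: "0 < a" and \<Phi>: "integrable lebesgue \<Phi>" and m: "integrable lebesgue m"
    and \<Phi>_le: "\<And>x. cmod (fourier \<Phi> x) \<le> A * tail_weight a x"
    and m_le: "\<And>z. \<bar>m z\<bar> \<le> B * tail_weight a z"
  shows "cmod (fourier (\<lambda>\<xi>. complex_of_real (jump_symbol m \<xi>) * \<Phi> \<xi>) x) \<le>
    A * (B * jump_const TYPE('a) a) * tail_weight a x"
proof -
  let ?w = "tail_weight a :: 'a \<Rightarrow> real"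
  have AB: "0 \<le> A" "0 \<le> B"
    using order.trans[OF norm_ge_zero \<Phi>_le[of 0]] order.trans[OF abs_ge_zero m_le[of 0]] 
      tail_weight_pos[of a "0::'a"] by (simp_all add: zero_le_mult_iff)
  let ?g = "\<lambda>z. A * B * (?w x * ?w z + (?w z * ?w (x - z) + ?w z * ?w (x + z)) / 2)"
  note conv = tail_weight_convolution[OF a, of x]
  have conv': "integrable lebesgue (\<lambda>z. ?w z * ?w (x + z))"
    "(LINT z|lebesgue. ?w z * ?w (x + z)) = (LINT z|lebesgue. ?w z * ?w (x - z))"
    using integrable_lebesgue_affine[OF conv(1), of "-1" 0] 
      lebesgue_integral_affine[of "\<lambda>z. ?w z * ?w (x - z)" "-1" 0] conv(1) by auto
  have g_int: "integrable lebesgue ?g"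
    by (intro integrable_mult_right Bochner_Integration.integrable_add integrable_divide
       conv(1) conv'(1) integrable_tail_weight a)
  have "cmod (fourier (\<lambda>\<xi>. complex_of_real (jump_symbol m \<xi>) * \<Phi> \<xi>) x) \<le> (LINT z|lebesgue. ?g z)"
    unfolding fourier_jump_symbol[OF \<Phi> m]
  proof (rule integral_norm_bound_dominated)
    fix z
    have "cmod (fourier \<Phi> x - (fourier \<Phi> (x - z) + fourier \<Phi> (x + z)) / 2) \<le> 
      cmod (fourier \<Phi> x) + cmod ((fourier \<Phi> (x - z) + fourier \<Phi> (x + z)) / 2)"
      by (rule norm_triangle_ineq4)
    also have "\<dots> \<le> cmod (fourier \<Phi> x) + (cmod (fourier \<Phi> (x - z)) + cmod (fourier \<Phi> (x + z))) / 2"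
      using norm_triangle_ineq[of "fourier \<Phi> (x - z)" "fourier \<Phi> (x + z)"] by (simp add: norm_divide)
    also have "\<dots> \<le> A * ?w x + (A * ?w (x - z) + A * ?w (x + z)) / 2"
      by (intro add_mono divide_right_mono \<Phi>_le) simp
    finally have "cmod (fourier \<Phi> x - (fourier \<Phi> (x - z) + fourier \<Phi> (x + z)) / 2) * \<bar>m z\<bar> \<le>
       (A * ?w x + (A * ?w (x - z) + A * ?w (x + z)) / 2) * (B * ?w z)"
      using m_le[of z] AB by (intro mult_mono) auto
    then show "cmod ((fourier \<Phi> x - (fourier \<Phi> (x - z) + fourier \<Phi> (x + z)) / 2) * complex_of_real (m z)) \<le> ?g z"
      unfolding norm_mult norm_of_real by (simp add: field_simps)
  qed (use g_int in auto)
  also have "\<dots> = A * B * (?w x * tail_mass TYPE('a) a + (LINT z|lebesgue. ?w z * ?w (x - z)))"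
    using conv(1) conv' integrable_tail_weight[OF a, where 'a='a]
    by (simp add: tail_mass_def)
  also have "\<dots> \<le> A * B * (?w x * tail_mass TYPE('a) a + 2 powr (real DIM('a) + a) * (2 * tail_mass TYPE('a) a) * ?w x)"
    using conv(2) AB by (intro mult_left_mono) auto
  finally show ?thesis
    by (simp add: jump_const_def algebra_simps)
qed

section \<open>Compound Poisson factors\<close>

lemma fourier_sum:
  assumes "finite I" "\<And>i. i \<in> I \<Longrightarrow> integrable lebesgue (\<Phi> i)"
  shows "fourier (\<lambda>\<xi>. \<Sum>i\<in>I. \<Phi> i \<xi>) x = (\<Sum>i\<in>I. fourier (\<Phi> i) x)"
  using integrable_fourier_integrand[OF assms(2), of _ x]
  by (simp add: fourier_def sum_distrib_left)

lemma exp_tail_sums: "(\<lambda>n. r ^ Suc n / fact (Suc n)) sums (exp r - 1)" for r :: real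
proof -
  have "(\<lambda>n. r ^ n / fact n) sums exp r"
    using exp_converges[of r] by (simp add: field_simps scaleR_conv_of_real)
  then show ?thesis
    using sums_Suc_iff[of "\<lambda>n. r ^ n / fact n" "exp r - 1"] by simp
qed

lemma fourier_jump_symbol_power_bound:
  fixes \<Phi> :: "'a::euclidean_space \<Rightarrow> complex"
  assumes a: "0 < a" and \<Phi>: "integrable lebesgue \<Phi>" and m: "integrable lebesgue m"
    and \<Phi>_le: "\<And>x. cmod (fourier \<Phi> x) \<le> A * tail_weight a x"
    and m_le: "\<And>z. \<bar>m z\<bar> \<le> B * tail_weight a z"
  shows "integrable lebesgue (\<lambda>\<xi>. complex_of_real ((- jump_symbol m \<xi>) ^ n) * \<Phi> \<xi>) \<and> (\<forall>x.
    cmod (fourier (\<lambda>\<xi>. complex_of_real ((- jump_symbol m \<xi>) ^ n) * \<Phi> \<xi>) x) \<le>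
    A * (B * jump_const TYPE('a) a) ^ n * tail_weight a x)"
proof (induction n)
  case (Suc n)
  define \<Psi> where "\<Psi> \<xi> = complex_of_real ((- jump_symbol m \<xi>) ^ n) * \<Phi> \<xi>" for \<xi>
  have eq: "(\<lambda>\<xi>. complex_of_real ((- jump_symbol m \<xi>) ^ Suc n) * \<Phi> \<xi>) =
     (\<lambda>\<xi>. (-1) * (complex_of_real (jump_symbol m \<xi>) * \<Psi> \<xi>))"
    by (auto simp: \<Psi>_def)
  have \<Psi>: "integrable lebesgue \<Psi>"
    and \<Psi>_le: "\<And>x. cmod (fourier \<Psi> x) \<le> A * (B * jump_const TYPE('a) a) ^ n * tail_weight a x"
    using Suc by (auto simp: \<Psi>_def[abs_def])
  have "integrable lebesgue (\<lambda>\<xi>. (-1) * (complex_of_real (jump_symbol m \<xi>) * \<Psi> \<xi>))"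
    by (intro integrable_mult_right integrable_mult_jump_symbol \<Psi> m)
  moreover have "cmod (fourier (\<lambda>\<xi>. (-1) * (complex_of_real (jump_symbol m \<xi>) * \<Psi> \<xi>)) x) \<le>
    A * (B * jump_const TYPE('a) a) ^ Suc n * tail_weight a x" for x
    using fourier_jump_symbol_bound[OF a \<Psi> m \<Psi>_le m_le, of x]
    unfolding fourier_scale by (simp add: mult_ac)
  ultimately show ?case unfolding eq by blast
qed (use assms in auto)

text \<open>
  The exponential series of the generator converges in the algebra of functions dominated by the
  weight. Starting the series at the first power keeps the bound small when \<open>B\<close> is small, and this is
  what makes the dependence on the kernel Lipschitz.
\<close>

lemma fourier_exp_jump_symbol_minus_one_bound:
  fixes \<Phi> :: "'a::euclidean_space \<Rightarrow> complex"
  assumes a: "0 < a" and \<Phi>: "integrable lebesgue \<Phi>" and m: "integrable lebesgue m"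
    and \<Phi>_le: "\<And>x. cmod (fourier \<Phi> x) \<le> A * tail_weight a x"
    and m_le: "\<And>z. \<bar>m z\<bar> \<le> B * tail_weight a z"
  shows "integrable lebesgue (\<lambda>\<xi>. complex_of_real (exp (- jump_symbol m \<xi>) - 1) * \<Phi> \<xi>)"
    and "cmod (fourier (\<lambda>\<xi>. complex_of_real (exp (- jump_symbol m \<xi>) - 1) * \<Phi> \<xi>) x) \<le>
    A * (exp (B * jump_const TYPE('a) a) - 1) * tail_weight a x"
proof -
  define u where "u \<xi> = - jump_symbol m \<xi>" for \<xi>
  define U where "U = 2 * (LINT z|lebesgue. \<bar>m z\<bar>)"
  define y where "y = B * jump_const TYPE('a) a"
  have AB: "0 \<le> A" "0 \<le> B"
    using order.trans[OF norm_ge_zero \<Phi>_le[of 0]] order.trans[OF abs_ge_zero m_le[of 0]] 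
      tail_weight_pos[of a "0::'a"] by (simp_all add: zero_le_mult_iff)
  have y: "0 \<le> y" unfolding y_def using AB jump_const_nonneg[where 'a='a and a=a] by simp
  have [measurable]: "\<Phi> \<in> borel_measurable lebesgue" "m \<in> borel_measurable lebesgue"
    using \<Phi> m by auto
  have [measurable]: "u \<in> borel_measurable lebesgue" unfolding u_def by measurable
  have u: "\<bar>u \<xi>\<bar> \<le> U" for \<xi> using abs_jump_symbol_le[OF m, of \<xi>] by (simp add: u_def U_def)
  let ?S = "\<lambda>N r. \<Sum>n<N. r ^ Suc n / fact (Suc n) :: real"
  have S_le: "?S N r \<le> exp r - 1" if "0 \<le> r" for r N
    unfolding sums_unique[OF exp_tail_sums]
    by (rule sum_le_suminf[OF sums_summable[OF exp_tail_sums]]) (use that in simp_all)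
  have S_abs: "\<bar>?S N (u \<xi>)\<bar> \<le> exp U" for N \<xi>
  proof -
    have "\<bar>?S N (u \<xi>)\<bar> \<le> ?S N \<bar>u \<xi>\<bar>"
      by (rule order.trans[OF sum_abs]) (simp add: abs_mult power_abs)
    also have "\<dots> \<le> exp \<bar>u \<xi>\<bar> - 1" by (rule S_le) simp
    also have "\<dots> \<le> exp U" using u[of \<xi>] exp_le_cancel_iff[of "\<bar>u \<xi>\<bar>" U] by linarith
    finally show ?thesis .
  qed
  have lim: "(\<lambda>N. ?S N (u \<xi>)) \<longlonglongrightarrow> exp (u \<xi>) - 1" for \<xi>
    using exp_tail_sums[of "u \<xi>"] by (simp add: sums_def)
  have dom: "integrable lebesgue (\<lambda>\<xi>. exp U * cmod (\<Phi> \<xi>))" using \<Phi> by simp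
  have exp_abs: "\<bar>exp (u \<xi>) - 1\<bar> \<le> exp U" for \<xi>
    by (rule LIMSEQ_le_const2[OF tendsto_rabs[OF lim]]) (use S_abs in blast)
  show int: "integrable lebesgue (\<lambda>\<xi>. complex_of_real (exp (- jump_symbol m \<xi>) - 1) * \<Phi> \<xi>)"
    unfolding u_def[symmetric]
    using dom by (rule Bochner_Integration.integrable_bound)
      (measurable, use exp_abs in \<open>auto intro!: mult_right_mono simp: norm_mult simp del: of_real_diff of_real_exp\<close>)
  note pow = fourier_jump_symbol_power_bound[OF a \<Phi> m \<Phi>_le m_le, folded u_def y_def]
  have term_eq: "complex_of_real (?S N (u \<xi>)) * \<Phi> \<xi> = 
     (\<Sum>n<N. complex_of_real (1 / fact (Suc n)) * (complex_of_real (u \<xi> ^ Suc n) * \<Phi> \<xi>))" for N \<xi>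
    by (simp add: sum_distrib_right)
  have partial: "cmod (fourier (\<lambda>\<xi>. complex_of_real (?S N (u \<xi>)) * \<Phi> \<xi>) x) \<le> A * (exp y - 1) * tail_weight a x" for N
  proof -
    have "fourier (\<lambda>\<xi>. complex_of_real (?S N (u \<xi>)) * \<Phi> \<xi>) x = 
      (\<Sum>n<N. complex_of_real (1 / fact (Suc n)) * fourier (\<lambda>\<xi>. complex_of_real (u \<xi> ^ Suc n) * \<Phi> \<xi>) x)"
      unfolding term_eq
      by (subst fourier_sum) (use pow in \<open>auto simp: fourier_scale simp del: of_real_divide of_real_power power_Suc\<close>)
    also have "cmod \<dots> \<le> (\<Sum>n<N. 1 / fact (Suc n) * (A * y ^ Suc n * tail_weight a x))"
      by (rule sum_norm_le) (use pow in \<open>auto simp: norm_mult simp del: of_real_divide of_real_power power_Suc fact_Suc intro!: divide_right_mono\<close>)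
    also have "\<dots> = A * tail_weight a x * ?S N y"
      by (simp add: sum_distrib_left mult_ac)
    also have "\<dots> \<le> A * tail_weight a x * (exp y - 1)"
      by (intro mult_left_mono S_le y mult_nonneg_nonneg AB tail_weight_nonneg)
    finally show ?thesis by (simp add: mult_ac)
  qed
  have "(\<lambda>N. fourier (\<lambda>\<xi>. complex_of_real (?S N (u \<xi>)) * \<Phi> \<xi>) x) \<longlonglongrightarrow> 
    fourier (\<lambda>\<xi>. complex_of_real (exp (u \<xi>) - 1) * \<Phi> \<xi>) x"
    unfolding fourier_def
  proof (rule integral_dominated_convergence[OF _ _ dom])
    show "AE \<xi> in lebesgue. (\<lambda>N. exp (- \<i> * complex_of_real (x \<bullet> \<xi>)) * (complex_of_real (?S N (u \<xi>)) * \<Phi> \<xi>))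
      \<longlonglongrightarrow> exp (- \<i> * complex_of_real (x \<bullet> \<xi>)) * (complex_of_real (exp (u \<xi>) - 1) * \<Phi> \<xi>)"
      by (intro AE_I2 tendsto_intros lim)
    show "AE \<xi> in lebesgue. cmod (exp (- \<i> * complex_of_real (x \<bullet> \<xi>)) * (complex_of_real (?S N (u \<xi>)) * \<Phi> \<xi>))
      \<le> exp U * cmod (\<Phi> \<xi>)" for N
    proof (rule AE_I2)
      fix \<xi>
      have "\<bar>?S N (u \<xi>)\<bar> * cmod (\<Phi> \<xi>) \<le> exp U * cmod (\<Phi> \<xi>)"
        by (intro mult_right_mono S_abs) simp
      then show "cmod (exp (- \<i> * complex_of_real (x \<bullet> \<xi>)) * (complex_of_real (?S N (u \<xi>)) * \<Phi> \<xi>))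
        \<le> exp U * cmod (\<Phi> \<xi>)"
        unfolding norm_mult norm_of_real by simp
    qed
  qed measurable
  then show "cmod (fourier (\<lambda>\<xi>. complex_of_real (exp (- jump_symbol m \<xi>) - 1) * \<Phi> \<xi>) x) \<le>
    A * (exp (B * jump_const TYPE('a) a) - 1) * tail_weight a x"
    using partial unfolding u_def[symmetric] y_def[symmetric]
    by (intro LIMSEQ_le_const2[OF tendsto_norm]) auto
qed

lemma fourier_exp_jump_symbol_bound:
  fixes \<Phi> :: "'a::euclidean_space \<Rightarrow> complex"
  assumes a: "0 < a" and \<Phi>: "integrable lebesgue \<Phi>" and m: "integrable lebesgue m"
    and \<Phi>_le: "\<And>x. cmod (fourier \<Phi> x) \<le> A * tail_weight a x"
    and m_le: "\<And>z. \<bar>m z\<bar> \<le> B * tail_weight a z"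
  shows "integrable lebesgue (\<lambda>\<xi>. complex_of_real (exp (- jump_symbol m \<xi>)) * \<Phi> \<xi>)"
    and "cmod (fourier (\<lambda>\<xi>. complex_of_real (exp (- jump_symbol m \<xi>)) * \<Phi> \<xi>) x) \<le>
    A * exp (B * jump_const TYPE('a) a) * tail_weight a x"
proof -
  note e = fourier_exp_jump_symbol_minus_one_bound[OF assms]
  have eq: "(\<lambda>\<xi>. complex_of_real (exp (- jump_symbol m \<xi>)) * \<Phi> \<xi>) =
    (\<lambda>\<xi>. complex_of_real (exp (- jump_symbol m \<xi>) - 1) * \<Phi> \<xi> + \<Phi> \<xi>)"
    by (simp add: algebra_simps)
  show "integrable lebesgue (\<lambda>\<xi>. complex_of_real (exp (- jump_symbol m \<xi>)) * \<Phi> \<xi>)"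
    unfolding eq using e(1) \<Phi> by (rule Bochner_Integration.integrable_add)
  have "cmod (fourier (\<lambda>\<xi>. complex_of_real (exp (- jump_symbol m \<xi>)) * \<Phi> \<xi>) x) \<le>
    A * (exp (B * jump_const TYPE('a) a) - 1) * tail_weight a x + A * tail_weight a x"
    unfolding eq fourier_add[OF e(1) \<Phi>]
    by (rule order.trans[OF norm_triangle_ineq add_mono[OF e(2) \<Phi>_le]])
  then show "cmod (fourier (\<lambda>\<xi>. complex_of_real (exp (- jump_symbol m \<xi>)) * \<Phi> \<xi>) x) \<le>
    A * exp (B * jump_const TYPE('a) a) * tail_weight a x"
    by (simp add: algebra_simps)
qed

section \<open>Exponential decay by a shift into the complex domain\<close>

text \<open>
  Let \<open>\<Psi> s\<close> continue \<open>\<Phi>\<close>, translated by \<open>s\<close> in the direction of \<open>x\<close>, to complex \<open>s\<close>. The Fourier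
  integral at \<open>x\<close> of the translate does not depend on real \<open>s\<close>, because Lebesgue measure is
  translation invariant. Being holomorphic in \<open>s\<close>, it does not depend on complex \<open>s\<close> either, so no
  contour has to be moved. An imaginary \<open>s\<close> turns the phase into exponential decay.
\<close>

lemma fourier_analytic_shift_bound:
  fixes \<Phi> :: "'a::euclidean_space \<Rightarrow> complex" and \<Psi> :: "complex \<Rightarrow> 'a \<Rightarrow> complex"
  assumes hol: "\<And>\<xi>. (\<lambda>s. \<Psi> s \<xi>) holomorphic_on ball 0 1"
    and ext: "\<And>\<xi> r. \<bar>r\<bar> < 1 \<Longrightarrow> \<Psi> (complex_of_real r) \<xi> = \<Phi> (\<xi> + r *\<^sub>R sgn x)"
    and meas: "\<And>s. s \<in> ball 0 1 \<Longrightarrow> \<Psi> s \<in> borel_measurable lebesgue"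
    and bound: "\<And>s \<xi>. s \<in> ball 0 1 \<Longrightarrow> cmod (\<Psi> s \<xi>) \<le> g \<xi>"
    and g: "integrable lebesgue g"
  shows "cmod (fourier \<Phi> x) \<le> exp (- norm x / 2) * (LINT \<xi>|lebesgue. g \<xi>)"
proof -
  define f where "f s \<xi> = exp (- \<i> * (complex_of_real (x \<bullet> \<xi>) + s * complex_of_real (norm x))) * \<Psi> s \<xi>" for s \<xi>
  define G where "G s = (LINT \<xi>|lebesgue. f s \<xi>)" for s
  have norm_f: "cmod (f s \<xi>) \<le> exp (Im s * norm x) * g \<xi>" if "s \<in> ball 0 1" for s \<xi>
    using bound[OF that, of \<xi>] by (simp add: f_def norm_mult norm_exp_eq_Re)
  have g0: "0 \<le> g \<xi>" for \<xi>
    using bound[of 0 \<xi>] order.trans[OF norm_ge_zero] by simp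
  have hol_G: "G holomorphic_on ball 0 1"
    unfolding G_def
  proof (rule holomorphic_on_parametric_integral)
    show "(\<lambda>s. f s \<xi>) holomorphic_on ball 0 1" for \<xi>
      unfolding f_def by (intro holomorphic_intros hol)
    show "f s \<in> borel_measurable lebesgue" if "s \<in> ball 0 1" for s
      unfolding f_def using meas[OF that] by measurable
    show "integrable lebesgue (\<lambda>\<xi>. exp (norm x) * g \<xi>)" using g by simp
    show "cmod (f s \<xi>) \<le> exp (norm x) * g \<xi>" if s: "s \<in> ball 0 1" for s \<xi>
    proof -
      have "Im s \<le> 1" using abs_Im_le_cmod[of s] s by simp
      then have "Im s * norm x \<le> norm x" by (metis mult_1 mult_right_mono norm_ge_zero)
      then show ?thesis
        using norm_f[OF s, of \<xi>] g0[of \<xi>] by (meson exp_le_cancel_iff mult_right_mono order.trans)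
    qed
  qed simp
  have \<Phi>_eq: "\<Phi> = \<Psi> 0" using ext[of 0] by (auto simp: fun_eq_iff)
  have [measurable]: "\<Phi> \<in> borel_measurable lebesgue"
    unfolding \<Phi>_eq by (rule meas) simp
  have real: "G (complex_of_real r) = fourier \<Phi> x" if r: "\<bar>r\<bar> < 1" for r
  proof -
    define h where "h \<xi> = exp (- \<i> * complex_of_real (x \<bullet> \<xi>)) * \<Phi> \<xi>" for \<xi>
    have h: "h \<in> borel_measurable lebesgue" unfolding h_def by measurable
    \<comment> \<open>This includes \<open>x = 0\<close>, where \<open>sgn x = 0\<close> and nothing is shifted.\<close>
    have "x \<bullet> sgn x = norm x" by (cases "x = 0") (simp_all add: sgn_div_norm dot_square_norm power2_eq_square)
    then have "f (complex_of_real r) \<xi> = h (r *\<^sub>R sgn x + 1 *\<^sub>R \<xi>)" for \<xi>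
      by (simp add: f_def h_def ext[OF r] inner_add_right add.commute)
    then have "G (complex_of_real r) = (LINT \<xi>|lebesgue. h (r *\<^sub>R sgn x + 1 *\<^sub>R \<xi>))"
      by (simp add: G_def)
    also have "\<dots> = (LINT \<xi>|lebesgue. h \<xi>)"
      using lebesgue_integral_affine[OF h, of 1 "r *\<^sub>R sgn x"] by simp
    finally show ?thesis by (simp add: fourier_def h_def)
  qed
  \<comment> \<open>Any point of the disc on the negative imaginary axis would do; it fixes the rate of decay.\<close>
  have "G (- \<i> / 2) - fourier \<Phi> x = 0"
  proof (rule analytic_continuation[of "\<lambda>s. G s - fourier \<Phi> x" "ball 0 1" "complex_of_real ` {-1<..<1}" 0])
    show "(\<lambda>s. G s - fourier \<Phi> x) holomorphic_on ball 0 1"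
      by (intro holomorphic_intros hol_G)
    show "0 islimpt complex_of_real ` {-1<..<1}"
      unfolding islimpt_approachable
    proof (intro allI impI)
      fix e :: real assume "0 < e"
      then show "\<exists>x'\<in>complex_of_real ` {- 1<..<1}. x' \<noteq> 0 \<and> dist x' 0 < e"
        by (intro bexI[OF _ imageI[of "min e 1 / 2"]]) (auto simp: min_def norm_divide)
    qed
  qed (use real in \<open>auto simp: norm_divide\<close>)
  then have "fourier \<Phi> x = (LINT \<xi>|lebesgue. f (- \<i> / 2) \<xi>)"
    by (simp add: G_def)
  also have "cmod \<dots> \<le> (LINT \<xi>|lebesgue. exp (- norm x / 2) * g \<xi>)"
    by (rule integral_norm_bound_dominated)
       (use norm_f[of "- \<i> / 2"] g in \<open>auto simp: norm_divide\<close>)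
  finally show ?thesis by simp
qed

text \<open>
  For large \<open>r\<close> a single term of the exponential series already dominates the power.
\<close>

lemma exp_powr_mult_bounded:
  fixes c \<alpha> q :: real
  assumes "0 < c" "0 < \<alpha>" "0 \<le> q"
  obtains C where "0 < C" "\<And>r. 0 \<le> r \<Longrightarrow> exp (- c * r powr \<alpha>) * (1 + r) powr q \<le> C"
proof -
  define n where "n = nat \<lceil>q / \<alpha>\<rceil>"
  have n: "q \<le> \<alpha> * real n"
  proof -
    have "q / \<alpha> \<le> real n" unfolding n_def by (rule real_nat_ceiling_ge)
    then show ?thesis using assms by (simp add: field_simps)
  qed
  define C where "C = 2 powr q * (1 + fact n / c ^ n)"
  have C: "0 < C" using assms by (auto simp: C_def intro!: mult_pos_pos add_pos_pos)
  have "exp (- c * r powr \<alpha>) * (1 + r) powr q \<le> C" if r: "0 \<le> r" for r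
  proof (cases "r \<le> 1")
    case True
    have "exp (- c * r powr \<alpha>) * (1 + r) powr q \<le> 1 * 2 powr q"
      using assms True r by (intro mult_mono powr_mono2) auto
    also have "\<dots> \<le> C" using assms by (simp add: C_def)
    finally show ?thesis .
  next
    case False
    have "(1 + r) powr q \<le> (2 * r) powr q"
      using assms False by (intro powr_mono2) auto
    also have "\<dots> = 2 powr q * r powr q" using False by (simp add: powr_mult)
    finally have 1: "(1 + r) powr q \<le> 2 powr q * r powr q" .
    have "r powr q \<le> r powr (\<alpha> * real n)"
      using n False by (intro powr_mono) auto
    also have "\<dots> = (r powr \<alpha>) ^ n"
      using False by (simp add: powr_powr flip: powr_realpow)
    also have "\<dots> = fact n / c ^ n * ((c * r powr \<alpha>) ^ n / fact n)"
      using assms by (simp add: power_mult_distrib)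
    also have "\<dots> \<le> fact n / c ^ n * exp (c * r powr \<alpha>)"
    proof -
      let ?y = "c * r powr \<alpha>"
      have s: "(\<lambda>n. ?y ^ n / fact n) sums exp ?y"
        using exp_converges[of ?y] by (simp add: field_simps scaleR_conv_of_real)
      have "?y ^ n / fact n \<le> exp ?y"
        using sum_le_suminf[OF sums_summable[OF s], of "{n}"] assms
        by (simp add: sums_unique[OF s, symmetric])
      then show ?thesis using assms by (intro mult_left_mono) auto
    qed
    finally have "2 powr q * r powr q \<le> 2 powr q * (fact n / c ^ n * exp (c * r powr \<alpha>))"
      by (rule mult_left_mono) simp
    with 1 have "(1 + r) powr q \<le> 2 powr q * (fact n / c ^ n * exp (c * r powr \<alpha>))"
      by (rule order.trans)
    then have "exp (- c * r powr \<alpha>) * (1 + r) powr q \<le> 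
      exp (- c * r powr \<alpha>) * (2 powr q * (fact n / c ^ n * exp (c * r powr \<alpha>)))"
      by (rule mult_left_mono) simp
    also have "\<dots> = 2 powr q * (fact n / c ^ n)"
      by (simp add: exp_minus)
    also have "\<dots> \<le> C" by (simp add: C_def distrib_left)
    finally show ?thesis .
  qed
  with C show ?thesis using that by blast
qed

section \<open>The symbol of the small jumps at complex frequencies\<close>

lemma norm_one_minus_cos_le:
  fixes u :: complex
  assumes "\<bar>Im u\<bar> \<le> 1"
  shows "cmod (1 - cos u) \<le> 2 * (cmod u)\<^sup>2"
proof -
  let ?S = "{w. Im w \<le> 1/2} \<inter> {w. - 1/2 \<le> Im w}"
  have cos_le: "cmod (cos w) \<le> 2" if "w \<in> ?S" for w
  proof -
    have "cmod (exp (\<i> * w)) \<le> exp (1/2)" "cmod (exp (- \<i> * w)) \<le> exp (1/2)"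
      using that by (auto simp: norm_exp_eq_Re)
    then have "cmod (exp (\<i> * w) + exp (- \<i> * w)) \<le> exp (1/2) + exp (1/2)"
      by (intro norm_triangle_le add_mono)
    then have "cmod (cos w) \<le> exp (1/2)"
      by (simp add: cos_exp_eq norm_divide)
    then show ?thesis using exp_half_le2 by linarith
  qed
  have "cmod (sin (u/2) - sin 0) \<le> 2 * cmod (u/2 - 0)"
  proof (rule field_differentiable_bound[of ?S sin cos])
    show "convex ?S"
      by (intro convex_Int convex_halfspace_Im_le convex_halfspace_Im_ge[of "-1/2", simplified])
        (use convex_halfspace_Im_ge[of "-1/2"] in simp)
    show "(sin has_field_derivative cos w) (at w within ?S)" for w :: complex
      by (rule DERIV_subset[OF DERIV_sin]) simp
  qed (use cos_le assms in auto)
  then have "cmod (sin (u/2)) \<le> cmod u" by (simp add: norm_divide)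
  then have "(cmod (sin (u/2)))\<^sup>2 \<le> (cmod u)\<^sup>2" by (rule power_mono) simp
  moreover have "1 - cos u = 2 * (sin (u/2))\<^sup>2"
    using cos_double_sin[of "u/2"] by simp
  ultimately show ?thesis by (simp add: norm_mult norm_power)
qed

text \<open>
  The real part of the complex cosine is \<open>cos (Re u) * cosh (Im u)\<close>, and \<open>cosh\<close> differs from 1 only
  to second order.
\<close>

lemma Re_one_minus_cos_ge:
  fixes u :: complex
  assumes "\<bar>Im u\<bar> \<le> 1"
  shows "1 - cos (Re u) - 2 * (Im u)\<^sup>2 \<le> Re (1 - cos u)"
proof -
  define C where "C = (exp (Im u) + exp (- Im u)) / 2"
  have C: "C - 1 \<le> 2 * (Im u)\<^sup>2" "1 \<le> C"
  proof -
    have "Re (1 - cos (\<i> * complex_of_real (Im u))) = 1 - C"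
      by (simp add: Re_cos C_def)
    then have "C - 1 \<le> cmod (1 - cos (\<i> * complex_of_real (Im u)))"
      using abs_Re_le_cmod[of "1 - cos (\<i> * complex_of_real (Im u))"] by linarith
    also have "\<dots> \<le> 2 * (cmod (\<i> * complex_of_real (Im u)))\<^sup>2"
      by (rule norm_one_minus_cos_le) (use assms in simp)
    finally show "C - 1 \<le> 2 * (Im u)\<^sup>2" by (simp add: norm_mult)
    show "1 \<le> C"
      using add_mono[OF exp_ge_add_one_self[of "Im u"] exp_ge_add_one_self[of "- Im u"]]
      by (simp add: C_def)
  qed
  have "cos (Re u) * (C - 1) \<le> 1 * (C - 1)"
    using C by (intro mult_right_mono) auto
  moreover have "Re (1 - cos u) = 1 - cos (Re u) * C" by (simp add: Re_cos C_def)
  ultimately show ?thesis using C by (simp add: algebra_simps)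
qed

text \<open>
  The points where the exponential is bounded by \<open>K\<close> form a half-plane, which is convex.
\<close>

lemma norm_exp_diff_le:
  fixes a b :: complex
  assumes "cmod (exp a) \<le> K" "cmod (exp b) \<le> K"
  shows "cmod (exp a - exp b) \<le> K * cmod (a - b)"
proof -
  have K: "0 < K" using assms(1) by (smt (verit) exp_not_eq_zero norm_le_zero_iff)
  let ?S = "{w. Re w \<le> ln K}"
  have S: "w \<in> ?S \<longleftrightarrow> cmod (exp w) \<le> K" for w
    using K by (simp add: norm_exp_eq_Re ln_ge_iff)
  show ?thesis
  proof (rule field_differentiable_bound[of ?S exp exp])
    show "(exp has_field_derivative exp w) (at w within ?S)" for w :: complex
      by (rule DERIV_subset[OF DERIV_exp]) simp
    show "convex ?S" by (rule convex_halfspace_Re_le)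
  qed (use assms S in blast)+
qed

definition small_jumps :: "('a::euclidean_space \<Rightarrow> real) \<Rightarrow> bool" where
  "small_jumps \<nu> \<longleftrightarrow> \<nu> \<in> borel_measurable lebesgue \<and> (\<forall>z. 1 < norm z \<longrightarrow> \<nu> z = 0) \<and>
     integrable lebesgue (\<lambda>z. (norm z)\<^sup>2 * \<bar>\<nu> z\<bar>)"

definition second_moment :: "('a::euclidean_space \<Rightarrow> real) \<Rightarrow> real" where
  "second_moment \<nu> = (LINT z|lebesgue. (norm z)\<^sup>2 * \<bar>\<nu> z\<bar>)"

text \<open>
  The symbol at the complex frequency \<open>\<xi> + s e\<close>. It exists because the jumps are bounded.
\<close>

definition tilted_symbol ::
  "('a::euclidean_space \<Rightarrow> real) \<Rightarrow> 'a \<Rightarrow> complex \<Rightarrow> 'a \<Rightarrow> complex" where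
  "tilted_symbol \<nu> e s \<xi> = (LINT z|lebesgue.
     (1 - cos (complex_of_real (\<xi> \<bullet> z) + s * complex_of_real (e \<bullet> z))) * complex_of_real (\<nu> z))"

context
  fixes \<nu> :: "'a::euclidean_space \<Rightarrow> real"
  assumes \<nu>: "small_jumps \<nu>"
begin

lemma small_jumps_measurable [measurable]: "\<nu> \<in> borel_measurable lebesgue"
  using \<nu> by (simp add: small_jumps_def)

lemma tilted_phase_bounds:
  assumes "norm e \<le> 1" "s \<in> ball 0 1" "norm z \<le> 1"
  shows "\<bar>Im (complex_of_real (\<xi> \<bullet> z) + s * complex_of_real (e \<bullet> z))\<bar> \<le> norm z"
    and "cmod (complex_of_real (\<xi> \<bullet> z) + s * complex_of_real (e \<bullet> z)) \<le> (1 + norm \<xi>) * norm z"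
proof -
  have e: "\<bar>e \<bullet> z\<bar> \<le> norm z"
    using Cauchy_Schwarz_ineq2[of e z] assms(1) mult_right_mono[of "norm e" 1 "norm z"] by simp
  have \<xi>: "\<bar>\<xi> \<bullet> z\<bar> \<le> norm \<xi> * norm z" by (rule Cauchy_Schwarz_ineq2)
  have s: "cmod s \<le> 1" "\<bar>Im s\<bar> \<le> 1"
    using assms(2) abs_Im_le_cmod[of s] by auto
  have "\<bar>Im s\<bar> * \<bar>e \<bullet> z\<bar> \<le> 1 * norm z"
    using e s by (intro mult_mono) auto
  then show "\<bar>Im (complex_of_real (\<xi> \<bullet> z) + s * complex_of_real (e \<bullet> z))\<bar> \<le> norm z"
    by (simp add: abs_mult)
  have "cmod s * \<bar>e \<bullet> z\<bar> \<le> 1 * norm z"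
    using e s by (intro mult_mono) auto
  then have "cmod (complex_of_real (\<xi> \<bullet> z)) + cmod (s * complex_of_real (e \<bullet> z)) \<le> norm \<xi> * norm z + norm z"
    using \<xi> by (simp add: norm_mult)
  then show "cmod (complex_of_real (\<xi> \<bullet> z) + s * complex_of_real (e \<bullet> z)) \<le> (1 + norm \<xi>) * norm z"
    using norm_triangle_ineq[of "complex_of_real (\<xi> \<bullet> z)" "s * complex_of_real (e \<bullet> z)"]
    by (simp add: algebra_simps)
qed

lemma tilted_integrand_bound:
  assumes "norm e \<le> 1" "s \<in> ball 0 1"
  shows "cmod ((1 - cos (complex_of_real (\<xi> \<bullet> z) + s * complex_of_real (e \<bullet> z))) * complex_of_real (\<nu> z))
    \<le> 2 * (1 + norm \<xi>)\<^sup>2 * ((norm z)\<^sup>2 * \<bar>\<nu> z\<bar>)"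
proof (cases "norm z \<le> 1")
  case True
  let ?u = "complex_of_real (\<xi> \<bullet> z) + s * complex_of_real (e \<bullet> z)"
  have "cmod (1 - cos ?u) \<le> 2 * (cmod ?u)\<^sup>2"
    by (rule norm_one_minus_cos_le[OF order.trans[OF tilted_phase_bounds(1)[OF assms True] True]])
  also have "\<dots> \<le> 2 * ((1 + norm \<xi>) * norm z)\<^sup>2"
    using tilted_phase_bounds(2)[OF assms True, of \<xi>] by (intro mult_left_mono power_mono) auto
  finally have "cmod (1 - cos ?u) * \<bar>\<nu> z\<bar> \<le> 2 * ((1 + norm \<xi>) * norm z)\<^sup>2 * \<bar>\<nu> z\<bar>"
    by (rule mult_right_mono) simp
  then show ?thesis by (simp only: norm_mult norm_of_real power_mult_distrib mult.assoc)
next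
  case False
  then show ?thesis using \<nu> by (auto simp: small_jumps_def)
qed

lemma integrable_tilted_dominator:
  "integrable lebesgue (\<lambda>z. c * ((norm z)\<^sup>2 * \<bar>\<nu> z\<bar>))"
  using \<nu> by (simp add: small_jumps_def)

lemma integrable_tilted_integrand:
  assumes "norm e \<le> 1" "s \<in> ball 0 1"
  shows "integrable lebesgue
    (\<lambda>z. (1 - cos (complex_of_real (\<xi> \<bullet> z) + s * complex_of_real (e \<bullet> z))) * complex_of_real (\<nu> z))"
proof (rule Bochner_Integration.integrable_bound[OF integrable_tilted_dominator])
  show "AE z in lebesgue. cmod ((1 - cos (complex_of_real (\<xi> \<bullet> z) + s * complex_of_real (e \<bullet> z))) * complex_of_real (\<nu> z))
    \<le> norm (2 * (1 + norm \<xi>)\<^sup>2 * ((norm z)\<^sup>2 * \<bar>\<nu> z\<bar>))"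
    using tilted_integrand_bound[OF assms] by (auto intro!: AE_I2 intro: order.trans[OF _ abs_ge_self])
qed measurable

lemma norm_tilted_symbol_le:
  assumes "norm e \<le> 1" "s \<in> ball 0 1"
  shows "cmod (tilted_symbol \<nu> e s \<xi>) \<le> 2 * (1 + norm \<xi>)\<^sup>2 * second_moment \<nu>"
proof -
  have "cmod (tilted_symbol \<nu> e s \<xi>) \<le> (LINT z|lebesgue. 2 * (1 + norm \<xi>)\<^sup>2 * ((norm z)\<^sup>2 * \<bar>\<nu> z\<bar>))"
    unfolding tilted_symbol_def
    by (rule integral_norm_bound_dominated[OF integrable_tilted_dominator tilted_integrand_bound[OF assms]])
  then show ?thesis by (simp add: second_moment_def)
qed

lemma tilted_symbol_holomorphic:
  assumes "norm e \<le> 1"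
  shows "(\<lambda>s. tilted_symbol \<nu> e s \<xi>) holomorphic_on ball 0 1"
  unfolding tilted_symbol_def
proof (rule holomorphic_on_parametric_integral)
  show "(\<lambda>s. (1 - cos (complex_of_real (\<xi> \<bullet> z) + s * complex_of_real (e \<bullet> z))) * complex_of_real (\<nu> z))
     holomorphic_on ball 0 1" for z
    by (intro holomorphic_intros)
qed (use tilted_integrand_bound[OF assms] integrable_tilted_dominator in auto)

lemma tilted_symbol_measurable [measurable]: "tilted_symbol \<nu> e s \<in> borel_measurable lebesgue"
  unfolding tilted_symbol_def
  by (rule lebesgue.borel_measurable_lebesgue_integral) measurable

lemma tilted_symbol_of_real:
  "tilted_symbol \<nu> e (complex_of_real r) \<xi> = complex_of_real (jump_symbol \<nu> (\<xi> + r *\<^sub>R e))"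
proof -
  have "(1 - cos (complex_of_real (\<xi> \<bullet> z) + complex_of_real r * complex_of_real (e \<bullet> z))) * complex_of_real (\<nu> z)
    = complex_of_real ((1 - cos ((\<xi> + r *\<^sub>R e) \<bullet> z)) * \<nu> z)" for z
    by (simp add: inner_add_left flip: cos_of_real)
  then show ?thesis by (simp add: tilted_symbol_def jump_symbol_def del: of_real_mult)
qed

lemma integrable_small_jump_symbol_integrand:
  "integrable lebesgue (\<lambda>z. (1 - cos (\<xi> \<bullet> z)) * \<nu> z)"
  using integrable_Re[OF integrable_tilted_integrand[of 0 0 \<xi>]] 
  by (simp add: Re_cos)

text \<open>
  Tilting by a bounded imaginary frequency costs at most a constant, since the excess of \<open>cosh\<close> over 1
  is paid for by the second moment.
\<close>

lemma Re_tilted_symbol_ge: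
  assumes nonneg: "\<And>z. 0 \<le> \<nu> z" and e: "norm e \<le> 1" and s: "s \<in> ball 0 1"
  shows "jump_symbol \<nu> (\<xi> + Re s *\<^sub>R e) - 2 * second_moment \<nu> \<le> Re (tilted_symbol \<nu> e s \<xi>)"
proof -
  let ?\<eta> = "\<xi> + Re s *\<^sub>R e"
  let ?h = "\<lambda>z. (1 - cos (complex_of_real (\<xi> \<bullet> z) + s * complex_of_real (e \<bullet> z))) * complex_of_real (\<nu> z)"
  have le: "(1 - cos (?\<eta> \<bullet> z)) * \<nu> z - 2 * ((norm z)\<^sup>2 * \<bar>\<nu> z\<bar>) \<le> Re (?h z)" for z
  proof (cases "norm z \<le> 1")
    case True
    define u where "u = complex_of_real (\<xi> \<bullet> z) + s * complex_of_real (e \<bullet> z)"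
    have im: "\<bar>Im u\<bar> \<le> norm z" unfolding u_def by (rule tilted_phase_bounds(1)[OF e s True])
    then have "(Im u)\<^sup>2 \<le> (norm z)\<^sup>2" using power_mono[OF im, of 2] by simp
    moreover have "cos (Re u) = cos (?\<eta> \<bullet> z)" by (simp add: u_def inner_add_left)
    moreover note Re_one_minus_cos_ge[OF order.trans[OF im True]]
    ultimately have "1 - cos (?\<eta> \<bullet> z) - 2 * (norm z)\<^sup>2 \<le> Re (1 - cos u)"
      by linarith
    then have "(1 - cos (?\<eta> \<bullet> z) - 2 * (norm z)\<^sup>2) * \<nu> z \<le> Re (1 - cos u) * \<nu> z"
      using nonneg by (rule mult_right_mono)
    then show ?thesis using nonneg[of z] unfolding u_def[symmetric] by (simp add: algebra_simps)
  next
    case False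
    then show ?thesis using \<nu> by (auto simp: small_jumps_def)
  qed
  have "jump_symbol \<nu> ?\<eta> - 2 * second_moment \<nu> =
      (LINT z|lebesgue. (1 - cos (?\<eta> \<bullet> z)) * \<nu> z - 2 * ((norm z)\<^sup>2 * \<bar>\<nu> z\<bar>))"
    using integrable_small_jump_symbol_integrand[of ?\<eta>] integrable_tilted_dominator[of 2]
    by (simp add: jump_symbol_def second_moment_def)
  also have "\<dots> \<le> (LINT z|lebesgue. Re (?h z))"
    by (intro integral_mono le Bochner_Integration.integrable_diff integrable_small_jump_symbol_integrand
        integrable_tilted_dominator integrable_Re integrable_tilted_integrand e s)
  also have "\<dots> = Re (tilted_symbol \<nu> e s \<xi>)"
    unfolding tilted_symbol_def by (rule integral_Re[OF integrable_tilted_integrand[OF e s]])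
  finally show ?thesis .
qed

end

lemma tilted_symbol_diff:
  assumes \<nu>: "small_jumps \<nu>" "small_jumps \<nu>'" and "norm e \<le> 1" "s \<in> ball 0 1"
  shows "tilted_symbol (\<lambda>z. \<nu> z - \<nu>' z) e s \<xi> = tilted_symbol \<nu> e s \<xi> - tilted_symbol \<nu>' e s \<xi>"
  using integrable_tilted_integrand[OF \<nu>(1) assms(3,4), of \<xi>] integrable_tilted_integrand[OF \<nu>(2) assms(3,4), of \<xi>]
  by (simp add: tilted_symbol_def right_diff_distrib)

lemma cos_quarter_less_one: "0 < 1 - cos (1/4 :: real)"
  using cos_monotone_0_pi[of 0 "1/4"] pi_ge_two by simp

text \<open>
  It is enough to count the jumps \<open>z\<close> in a ball of radius comparable to \<open>1 / norm \<xi>\<close> on which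
  \<open>\<xi> \<bullet> z\<close> stays away from 0 and from \<open>2 * pi\<close>: there the integrand is at least a multiple of
  \<open>norm \<xi> powr (d + \<alpha>)\<close>, and the volume of the ball is of order \<open>norm \<xi> powr - d\<close>.
\<close>

lemma small_jump_symbol_lower_bound:
  fixes \<nu> :: "'a::euclidean_space \<Rightarrow> real"
  assumes \<nu>: "small_jumps \<nu>" and nonneg: "\<And>z. 0 \<le> \<nu> z" and \<alpha>: "0 < \<alpha>" and \<kappa>\<^sub>0: "0 < \<kappa>\<^sub>0"
    and ge: "\<And>z. z \<noteq> 0 \<Longrightarrow> norm z \<le> 1 \<Longrightarrow> \<kappa>\<^sub>0 / norm z powr (real DIM('a) + \<alpha>) \<le> \<nu> z"
    and \<xi>: "1 \<le> norm \<xi>"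
  shows "(1 - cos (1/4)) * \<kappa>\<^sub>0 * unit_ball_vol DIM('a) / 4 ^ DIM('a) * norm \<xi> powr \<alpha> \<le> jump_symbol \<nu> \<xi>"
proof -
  let ?p = "real DIM('a) + \<alpha>"
  define r where "r = norm \<xi>"
  \<comment> \<open>At the centre \<open>\<xi> \<bullet> b = 1/2\<close>; on the ball \<open>\<xi> \<bullet> z\<close> lies between 1/4 and 3/4.\<close>
  define b where "b = (1 / (2 * r\<^sup>2)) *\<^sub>R \<xi>"
  define B where "B = cball b (1 / (4 * r))"
  define C where "C = (1 - cos (1/4)) * (\<kappa>\<^sub>0 * r powr ?p)"
  have r: "1 \<le> r" using \<xi> by (simp add: r_def)
  have cos4: "0 < 1 - cos (1/4 :: real)"
    by (rule cos_quarter_less_one)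
  have le: "C * indicator B z \<le> (1 - cos (\<xi> \<bullet> z)) * \<nu> z" for z
  proof (cases "z \<in> B")
    case True
    have d: "norm (z - b) \<le> 1 / (4 * r)"
      using True by (simp add: B_def dist_norm norm_minus_commute)
    have nb: "norm b = 1 / (2 * r)"
      using r by (simp add: b_def power2_eq_square flip: r_def)
    have "norm z \<le> norm b + norm (z - b)" by norm
    then have nz: "norm z \<le> 1 / r" using d nb r by (simp add: field_simps)
    have "norm b \<le> norm z + norm (z - b)" by norm
    then have z0: "z \<noteq> 0" using d nb r by (auto simp: field_simps)
    have inner: "\<bar>\<xi> \<bullet> z - 1/2\<bar> \<le> 1/4"
    proof -
      have "\<xi> \<bullet> b = 1/2"
        using r by (simp add: b_def power2_eq_square dot_square_norm flip: r_def)
      then have "\<bar>\<xi> \<bullet> z - 1/2\<bar> = \<bar>\<xi> \<bullet> (z - b)\<bar>" by (simp add: inner_diff_right)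
      also have "\<dots> \<le> r * norm (z - b)" unfolding r_def by (rule Cauchy_Schwarz_ineq2)
      also have "\<dots> \<le> r * (1 / (4 * r))" using d r by (intro mult_left_mono) auto
      finally show ?thesis using r by simp
    qed
    have c: "1 - cos (1/4) \<le> 1 - cos (\<xi> \<bullet> z)"
    proof -
      have "1/4 \<le> \<xi> \<bullet> z" "\<xi> \<bullet> z \<le> pi" using inner pi_ge_two by linarith+
      then show ?thesis using cos_monotone_0_pi_le[of "1/4" "\<xi> \<bullet> z"] by simp
    qed
    have "1 / r \<le> 1" using r by simp
    then have nz1: "norm z \<le> 1" using nz by linarith
    have "norm z powr ?p \<le> (1 / r) powr ?p"
      using nz \<alpha> by (intro powr_mono2) auto
    also have "\<dots> = 1 / r powr ?p" using r by (simp add: powr_divide)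
    finally have "\<kappa>\<^sub>0 * r powr ?p \<le> \<kappa>\<^sub>0 / norm z powr ?p"
      using z0 r \<kappa>\<^sub>0 by (simp add: field_simps)
    also have "\<dots> \<le> \<nu> z" by (rule ge[OF z0 nz1])
    finally have "C \<le> (1 - cos (\<xi> \<bullet> z)) * \<nu> z"
      unfolding C_def using c cos4 \<kappa>\<^sub>0 by (intro mult_mono) auto
    then show ?thesis using True by simp
  next
    case False
    then show ?thesis using nonneg[of z] one_minus_cos_bounds(1) by simp
  qed
  have B: "B \<in> sets lebesgue" "emeasure lebesgue B < \<infinity>"
    using emeasure_lborel_cball_finite[of b "1 / (4 * r)"] by (auto simp: B_def)
  have "measure lebesgue B = unit_ball_vol DIM('a) * (1 / (4 * r)) ^ DIM('a)"
    using r by (simp add: B_def content_cball)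
  then have "C * measure lebesgue B = 
     (1 - cos (1/4)) * \<kappa>\<^sub>0 * unit_ball_vol DIM('a) / 4 ^ DIM('a) * r powr \<alpha>"
    using r by (simp add: C_def powr_add powr_realpow power_divide power_mult_distrib field_simps)
  moreover have "C * measure lebesgue B = (LINT z|lebesgue. C * indicator B z)"
    using B by simp
  moreover have "(LINT z|lebesgue. C * indicator B z) \<le> jump_symbol \<nu> \<xi>"
    unfolding jump_symbol_def
    using B by (intro integral_mono integrable_small_jump_symbol_integrand[OF \<nu>] le) auto
  ultimately show ?thesis unfolding r_def[symmetric] by metis
qed

section \<open>Splitting the Levy density at jumps of size one\<close>

definition small_part :: "real \<Rightarrow> ('a::euclidean_space \<Rightarrow> real) \<Rightarrow> 'a \<Rightarrow> real" where
  "small_part \<alpha> \<kappa> z = levy_density \<alpha> \<kappa> z * indicator (cball 0 1) z"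

definition large_part :: "real \<Rightarrow> ('a::euclidean_space \<Rightarrow> real) \<Rightarrow> 'a \<Rightarrow> real" where
  "large_part \<alpha> \<kappa> z = levy_density \<alpha> \<kappa> z * indicator (- cball 0 1) z"

text \<open>
  The second moment of the jumps of size at most one when the kernel is identically 1.
\<close>

definition unit_second_moment :: "'a::euclidean_space itself \<Rightarrow> real \<Rightarrow> real" where
  "unit_second_moment _ \<alpha> = (LINT z|lebesgue.
     (norm z)\<^sup>2 / norm z powr (real DIM('a) + \<alpha>) * indicator (cball (0::'a) 1) z)"

lemma levy_density_measurable [measurable]:
  assumes [measurable]: "\<kappa> \<in> borel_measurable lebesgue"
  shows "levy_density \<alpha> \<kappa> \<in> borel_measurable lebesgue"
  unfolding levy_density_def by measurable

lemma small_part_measurable [measurable]: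
  assumes [measurable]: "\<kappa> \<in> borel_measurable lebesgue"
  shows "small_part \<alpha> \<kappa> \<in> borel_measurable lebesgue"
  unfolding small_part_def by measurable

lemma large_part_measurable [measurable]:
  assumes [measurable]: "\<kappa> \<in> borel_measurable lebesgue"
  shows "large_part \<alpha> \<kappa> \<in> borel_measurable lebesgue"
proof -
  have [measurable]: "- cball (0::'a) 1 \<in> sets lebesgue" by (simp add: Compl_in_sets_lebesgue)
  show ?thesis unfolding large_part_def by measurable
qed

lemma small_part_diff: "small_part \<alpha> (\<lambda>z. \<kappa> z - \<kappa>' z) = (\<lambda>z. small_part \<alpha> \<kappa> z - small_part \<alpha> \<kappa>' z)"
  by (simp add: fun_eq_iff small_part_def levy_density_def algebra_simps diff_divide_distrib)

lemma large_part_diff: "large_part \<alpha> (\<lambda>z. \<kappa> z - \<kappa>' z) = (\<lambda>z. large_part \<alpha> \<kappa> z - large_part \<alpha> \<kappa>' z)"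
  by (simp add: fun_eq_iff large_part_def levy_density_def algebra_simps diff_divide_distrib)

lemma small_part_small_jumps:
  fixes \<kappa> :: "'a::euclidean_space \<Rightarrow> real"
  assumes \<alpha>: "0 < \<alpha>" "\<alpha> < 2" and [measurable]: "\<kappa> \<in> borel_measurable lebesgue"
    and le: "\<And>z. \<bar>\<kappa> z\<bar> \<le> \<delta>"
  shows "small_jumps (small_part \<alpha> \<kappa>)"
    and "second_moment (small_part \<alpha> \<kappa>) \<le> \<delta> * unit_second_moment TYPE('a) \<alpha>"
proof -
  let ?g = "\<lambda>z::'a. \<delta> * ((norm z)\<^sup>2 / norm z powr (real DIM('a) + \<alpha>) * indicator (cball 0 1) z)"
  have g: "integrable lebesgue ?g"
    by (rule integrable_mult_right[OF integrable_small_jumps[OF \<alpha>]])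
  have bound: "(norm z)\<^sup>2 * \<bar>small_part \<alpha> \<kappa> z\<bar> \<le> ?g z" for z
  proof -
    have "\<bar>\<kappa> z\<bar> * ((norm z)\<^sup>2 / norm z powr (real DIM('a) + \<alpha>) * indicator (cball 0 1) z) \<le> ?g z"
      by (rule mult_right_mono[OF le]) simp
    then show ?thesis
      by (simp add: small_part_def levy_density_def abs_mult mult_ac)
  qed
  have int: "integrable lebesgue (\<lambda>z. (norm z)\<^sup>2 * \<bar>small_part \<alpha> \<kappa> z\<bar>)"
    using g by (rule integrable_dominated) (measurable, use bound in simp)
  then show "small_jumps (small_part \<alpha> \<kappa>)"
    unfolding small_jumps_def by (auto simp: small_part_def[of _ _ z for z])
  have "second_moment (small_part \<alpha> \<kappa>) \<le> (LINT z|lebesgue. ?g z)"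
    unfolding second_moment_def by (intro integral_mono int g bound)
  then show "second_moment (small_part \<alpha> \<kappa>) \<le> \<delta> * unit_second_moment TYPE('a) \<alpha>"
    by (simp only: integral_mult_right_zero unit_second_moment_def)
qed

lemma large_part_bound:
  fixes \<kappa> :: "'a::euclidean_space \<Rightarrow> real"
  assumes \<alpha>: "0 < \<alpha>" and [measurable]: "\<kappa> \<in> borel_measurable lebesgue"
    and le: "\<And>z. \<bar>\<kappa> z\<bar> \<le> \<delta>"
  shows "\<bar>large_part \<alpha> \<kappa> z\<bar> \<le> \<delta> * 2 powr (real DIM('a) + \<alpha>) * tail_weight \<alpha> z"
    and "integrable lebesgue (large_part \<alpha> \<kappa>)"
proof -
  let ?p = "real DIM('a) + \<alpha>"
  have \<delta>: "0 \<le> \<delta>" using le[of 0] by linarith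
  show bound: "\<bar>large_part \<alpha> \<kappa> z\<bar> \<le> \<delta> * 2 powr ?p * tail_weight \<alpha> z" for z
  proof (cases "norm z \<le> 1")
    case True
    then show ?thesis using \<delta> by (simp add: large_part_def)
  next
    case False
    have "((1 + norm z) / 2) powr ?p \<le> norm z powr ?p"
      using False \<alpha> by (intro powr_mono2) auto
    then have "\<bar>\<kappa> z\<bar> / norm z powr ?p \<le> \<delta> / ((1 + norm z) / 2) powr ?p"
      using False \<delta> le by (intro frac_le) auto
    also have "\<dots> = \<delta> * 2 powr ?p * tail_weight \<alpha> z"
      unfolding tail_weight_def powr_minus by (simp only: powr_divide) (simp add: divide_simps)
    finally show ?thesis
      using False by (simp add: large_part_def levy_density_def)
  qed
  have g: "integrable lebesgue (\<lambda>z::'a. \<delta> * 2 powr ?p * tail_weight \<alpha> z)"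
    by (rule integrable_mult_right[OF integrable_tail_weight[OF \<alpha>]])
  then show "integrable lebesgue (large_part \<alpha> \<kappa>)"
    by (rule integrable_dominated) (measurable, use bound in simp)
qed

lemma levy_symbol_split:
  fixes \<kappa> :: "'a::euclidean_space \<Rightarrow> real"
  assumes \<alpha>: "0 < \<alpha>" "\<alpha> < 2" and [measurable]: "\<kappa> \<in> borel_measurable lebesgue"
    and le: "\<And>z. \<bar>\<kappa> z\<bar> \<le> \<delta>"
  shows "levy_symbol \<alpha> \<kappa> \<xi> = jump_symbol (small_part \<alpha> \<kappa>) \<xi> + jump_symbol (large_part \<alpha> \<kappa>) \<xi>"
proof -
  have "(1 - cos (\<xi> \<bullet> z)) * levy_density \<alpha> \<kappa> z =
    (1 - cos (\<xi> \<bullet> z)) * small_part \<alpha> \<kappa> z + (1 - cos (\<xi> \<bullet> z)) * large_part \<alpha> \<kappa> z" for z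
    by (simp add: small_part_def large_part_def indicator_def)
  then show ?thesis
    using integrable_small_jump_symbol_integrand[OF small_part_small_jumps(1)[OF \<alpha> assms(3) le], of \<xi>]
      integrable_jump_symbol_integrand[OF large_part_bound(2)[OF \<alpha>(1) assms(3) le], of \<xi>]
    by (simp add: levy_symbol_def jump_symbol_def)
qed

text \<open>
  Uniformly in the kernel, the characteristic function of the small jumps decays like
  \<open>exp (- c * norm \<xi> powr \<alpha>)\<close>, also at slightly complex frequencies. The factor quadratic in \<open>\<xi>\<close> is
  reserved for the symbol itself, which appears when two kernels are compared. The weight on the right
  is only a convenient integrable function of \<open>\<xi>\<close>.
\<close>

lemma tilted_small_part_decay:
  fixes \<alpha> \<kappa>\<^sub>0 \<kappa>\<^sub>1 :: real
  assumes \<alpha>: "0 < \<alpha>" "\<alpha> < 2" and \<kappa>\<^sub>0: "0 < \<kappa>\<^sub>0" and \<kappa>\<^sub>1: "0 \<le> \<kappa>\<^sub>1"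
  obtains C where "0 < C" and
    "\<And>(\<kappa> :: 'a::euclidean_space \<Rightarrow> real) e s \<xi>. admissible_kernel \<kappa>\<^sub>0 \<kappa>\<^sub>1 \<kappa> \<Longrightarrow> norm e \<le> 1 \<Longrightarrow> s \<in> ball 0 1 \<Longrightarrow>
       (1 + norm \<xi>)\<^sup>2 * cmod (exp (- tilted_symbol (small_part \<alpha> \<kappa>) e s \<xi>)) \<le> C * tail_weight \<alpha> \<xi>"
proof -
  let ?p = "real DIM('a) + \<alpha>"
  define c where "c = (1 - cos (1/4)) * \<kappa>\<^sub>0 * unit_ball_vol DIM('a) / 4 ^ DIM('a)"
  have c: "0 < c" using \<kappa>\<^sub>0 cos_quarter_less_one by (simp add: c_def)
  obtain D where D: "0 < D" "\<And>r. 0 \<le> r \<Longrightarrow> exp (- c * r powr \<alpha>) * (1 + r) powr (?p + 2) \<le> D"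
    using exp_powr_mult_bounded[OF c \<alpha>(1), of "?p + 2"] \<alpha> by auto
  define M where "M = \<kappa>\<^sub>1 * unit_second_moment TYPE('a) \<alpha>"
  define C where "C = exp (2 * M) * exp c * 2 powr (?p + 2) * D"
  show ?thesis
  proof (rule that)
    show "0 < C" using D by (simp add: C_def)
    fix \<kappa> :: "'a \<Rightarrow> real" and e :: 'a and s :: complex and \<xi> :: 'a
    assume adm: "admissible_kernel \<kappa>\<^sub>0 \<kappa>\<^sub>1 \<kappa>" and e: "norm e \<le> 1" and s: "s \<in> ball 0 1"
    have \<kappa>: "\<kappa> \<in> borel_measurable lebesgue" "\<And>z. \<bar>\<kappa> z\<bar> \<le> \<kappa>\<^sub>1" "\<And>z. \<kappa>\<^sub>0 \<le> \<kappa> z"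
      using adm \<kappa>\<^sub>0 by (auto simp: admissible_kernel_def abs_le_iff) (smt (verit))
    let ?\<nu> = "small_part \<alpha> \<kappa>"
    note \<nu> = small_part_small_jumps[OF \<alpha> \<kappa>(1,2)]
    have nonneg: "0 \<le> ?\<nu> z" for z
      using \<kappa>(3)[of z] \<kappa>\<^sub>0 by (simp add: small_part_def levy_density_def)
    define \<eta> where "\<eta> = \<xi> + Re s *\<^sub>R e"
    \<comment> \<open>Subtracting \<open>c\<close> makes the lower bound true for low frequencies as well.\<close>
    have J: "c * norm \<eta> powr \<alpha> - c \<le> jump_symbol ?\<nu> \<eta>"
    proof (cases "1 \<le> norm \<eta>")
      case True
      have "c * norm \<eta> powr \<alpha> \<le> jump_symbol ?\<nu> \<eta>"
        unfolding c_def
        by (rule small_jump_symbol_lower_bound[OF \<nu>(1) nonneg \<alpha>(1) \<kappa>\<^sub>0 _ True])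
          (use \<kappa>(3) in \<open>auto simp: small_part_def levy_density_def divide_right_mono\<close>)
      then show ?thesis using c by linarith
    next
      case False
      have "norm \<eta> powr \<alpha> \<le> 1 powr \<alpha>" using False \<alpha> by (intro powr_mono2) auto
      then have "c * norm \<eta> powr \<alpha> \<le> c" using c by simp
      moreover have "0 \<le> jump_symbol ?\<nu> \<eta>"
        unfolding jump_symbol_def using nonneg one_minus_cos_bounds(1)
        by (intro Bochner_Integration.integral_nonneg mult_nonneg_nonneg)
      ultimately show ?thesis by linarith
    qed
    have "- Re (tilted_symbol ?\<nu> e s \<xi>) \<le> 2 * M + c - c * norm \<eta> powr \<alpha>"
      using Re_tilted_symbol_ge[OF \<nu>(1) nonneg e s, of \<xi>] \<nu>(2) J unfolding \<eta>_def[symmetric] M_def by linarith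
    then have 1: "cmod (exp (- tilted_symbol ?\<nu> e s \<xi>)) \<le> exp (2 * M) * exp c * exp (- c * norm \<eta> powr \<alpha>)"
      by (simp add: norm_exp_eq_Re flip: exp_add)
    define v where "v = Re s *\<^sub>R e"
    have "norm v \<le> 1 * 1"
      unfolding v_def norm_scaleR using s e abs_Re_le_cmod[of s] by (intro mult_mono) auto
    moreover have "norm \<xi> \<le> norm \<eta> + norm v"
      using norm_triangle_ineq4[of \<eta> v] by (simp add: \<eta>_def v_def)
    ultimately have "norm \<xi> \<le> norm \<eta> + 1" by simp
    then have "norm \<xi> + 0 \<le> (norm \<eta> + 1) + norm \<eta>" by (intro add_mono) auto
    then have "1 + norm \<xi> \<le> 2 * (1 + norm \<eta>)" by simp
    then have "(1 + norm \<xi>) powr (?p + 2) \<le> (2 * (1 + norm \<eta>)) powr (?p + 2)"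
      using \<alpha> by (intro powr_mono2) auto
    also have "\<dots> = 2 powr (?p + 2) * (1 + norm \<eta>) powr (?p + 2)"
      by (subst powr_mult) auto
    finally have "(1 + norm \<xi>) powr (?p + 2) * cmod (exp (- tilted_symbol ?\<nu> e s \<xi>)) \<le>
      (2 powr (?p + 2) * (1 + norm \<eta>) powr (?p + 2)) * (exp (2 * M) * exp c * exp (- c * norm \<eta> powr \<alpha>))"
      using 1 by (intro mult_mono) auto
    also have "\<dots> = exp (2 * M) * exp c * 2 powr (?p + 2) * (exp (- c * norm \<eta> powr \<alpha>) * (1 + norm \<eta>) powr (?p + 2))"
      by (simp only: mult_ac)
    also have "\<dots> \<le> C"
      unfolding C_def by (intro mult_left_mono D) auto
    finally have le: "(1 + norm \<xi>) powr (?p + 2) * cmod (exp (- tilted_symbol ?\<nu> e s \<xi>)) \<le> C" .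
    have "0 < 1 + norm \<xi>" using norm_ge_zero[of \<xi>] by linarith
    then have "tail_weight \<alpha> \<xi> * (1 + norm \<xi>) powr (?p + 2) = (1 + norm \<xi>)\<^sup>2"
      by (simp add: tail_weight_def flip: powr_add)
    then have "(1 + norm \<xi>)\<^sup>2 * cmod (exp (- tilted_symbol ?\<nu> e s \<xi>)) =
       tail_weight \<alpha> \<xi> * ((1 + norm \<xi>) powr (?p + 2) * cmod (exp (- tilted_symbol ?\<nu> e s \<xi>)))"
      by (metis mult.assoc)
    also have "\<dots> \<le> tail_weight \<alpha> \<xi> * C"
      by (rule mult_left_mono[OF le]) simp
    finally show "(1 + norm \<xi>)\<^sup>2 * cmod (exp (- tilted_symbol ?\<nu> e s \<xi>)) \<le> C * tail_weight \<alpha> \<xi>"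
      by (simp only: mult.commute)
  qed
qed

section \<open>The kernel at unit time\<close>

definition small_char :: "real \<Rightarrow> ('a::euclidean_space \<Rightarrow> real) \<Rightarrow> 'a \<Rightarrow> complex" where
  "small_char \<alpha> \<kappa> \<xi> = complex_of_real (exp (- jump_symbol (small_part \<alpha> \<kappa>) \<xi>))"

lemma small_char_conv_tilted:
  assumes "small_jumps (small_part \<alpha> \<kappa>)"
  shows "exp (- tilted_symbol (small_part \<alpha> \<kappa>) e (complex_of_real r) \<xi>) = small_char \<alpha> \<kappa> (\<xi> + r *\<^sub>R e)"
  by (simp add: small_char_def tilted_symbol_of_real[OF assms] exp_of_real flip: of_real_minus)

text \<open>
  Bounded jumps give exponentially decaying densities, by the analytic shift. For the difference of two
  kernels the same shift applies to the difference of the characteristic functions, which is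
  proportional to the difference of the symbols, and hence of the kernels.
\<close>

lemma small_kernel_bounds:
  fixes \<alpha> \<kappa>\<^sub>0 \<kappa>\<^sub>1 :: real
  assumes \<alpha>: "0 < \<alpha>" "\<alpha> < 2" and \<kappa>\<^sub>0: "0 < \<kappa>\<^sub>0" and \<kappa>\<^sub>1: "0 \<le> \<kappa>\<^sub>1"
  obtains A where "0 < A"
    "\<And>\<kappa> :: 'a::euclidean_space \<Rightarrow> real. admissible_kernel \<kappa>\<^sub>0 \<kappa>\<^sub>1 \<kappa> \<Longrightarrow> integrable lebesgue (small_char \<alpha> \<kappa>)"
    "\<And>(\<kappa> :: 'a \<Rightarrow> real) x. admissible_kernel \<kappa>\<^sub>0 \<kappa>\<^sub>1 \<kappa> \<Longrightarrow> cmod (fourier (small_char \<alpha> \<kappa>) x) \<le> A * tail_weight \<alpha> x"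
    "\<And>(\<kappa> :: 'a \<Rightarrow> real) \<kappa>' \<delta> x. admissible_kernel \<kappa>\<^sub>0 \<kappa>\<^sub>1 \<kappa> \<Longrightarrow> admissible_kernel \<kappa>\<^sub>0 \<kappa>\<^sub>1 \<kappa>' \<Longrightarrow> 
      (\<And>z. \<bar>\<kappa> z - \<kappa>' z\<bar> \<le> \<delta>) \<Longrightarrow> 
      cmod (fourier (\<lambda>\<xi>. small_char \<alpha> \<kappa> \<xi> - small_char \<alpha> \<kappa>' \<xi>) x) \<le> (A * \<delta>) * tail_weight \<alpha> x"
proof -
  let ?p = "real DIM('a) + \<alpha>"
  let ?w = "tail_weight \<alpha> :: 'a \<Rightarrow> real"
  obtain C where C: "0 < C" and decay: "\<And>(\<kappa> :: 'a \<Rightarrow> real) e s \<xi>. admissible_kernel \<kappa>\<^sub>0 \<kappa>\<^sub>1 \<kappa> \<Longrightarrow> norm e \<le> 1 \<Longrightarrow> s \<in> ball 0 1 \<Longrightarrow>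
       (1 + norm \<xi>)\<^sup>2 * cmod (exp (- tilted_symbol (small_part \<alpha> \<kappa>) e s \<xi>)) \<le> C * ?w \<xi>"
    using tilted_small_part_decay[OF \<alpha> \<kappa>\<^sub>0 \<kappa>\<^sub>1, where 'a='a] by blast
  obtain D where D: "0 < D" "\<And>r. 0 \<le> r \<Longrightarrow> exp (- (1/2) * r powr 1) * (1 + r) powr ?p \<le> D"
    using exp_powr_mult_bounded[of "1/2" 1 ?p] \<alpha> by auto
  have exp_le: "exp (- norm x / 2) \<le> D * ?w x" for x
  proof -
    have "0 < 1 + norm x" using norm_ge_zero[of x] by linarith
    then have "0 < (1 + norm x) powr ?p" by simp
    then show ?thesis
      using D(2)[of "norm x"] unfolding tail_weight_def powr_minus
      by (simp add: field_simps)
  qed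
  define I where "I = unit_second_moment TYPE('a) \<alpha>"
  have I: "0 \<le> I" unfolding I_def unit_second_moment_def by (intro Bochner_Integration.integral_nonneg) auto
  have int_w: "integrable lebesgue (\<lambda>\<xi>. c * ?w \<xi>)" for c
    by (rule integrable_mult_right[OF integrable_tail_weight[OF \<alpha>(1)]])
  define W where "W = (LINT \<xi>|lebesgue. ?w \<xi>)"
  have W: "0 \<le> W" unfolding W_def by (intro Bochner_Integration.integral_nonneg) auto
  define A where "A = D * (C * W) + D * (2 * I * C * W) + 1"
  have decay1: "cmod (exp (- tilted_symbol (small_part \<alpha> \<kappa>) e s \<xi>)) \<le> C * ?w \<xi>"
    if "admissible_kernel \<kappa>\<^sub>0 \<kappa>\<^sub>1 \<kappa>" "norm e \<le> 1" "s \<in> ball 0 1" for \<kappa> :: "'a \<Rightarrow> real" and e s \<xi>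
  proof -
    have "1 * cmod (exp (- tilted_symbol (small_part \<alpha> \<kappa>) e s \<xi>)) \<le> (1 + norm \<xi>)\<^sup>2 * cmod (exp (- tilted_symbol (small_part \<alpha> \<kappa>) e s \<xi>))"
      by (rule mult_right_mono) (auto simp: one_le_power)
    then show ?thesis using decay[OF that, of \<xi>] by linarith
  qed
  have sj: "\<kappa> \<in> borel_measurable lebesgue" "small_jumps (small_part \<alpha> \<kappa>)"
    if "admissible_kernel \<kappa>\<^sub>0 \<kappa>\<^sub>1 \<kappa>" for \<kappa> :: "'a \<Rightarrow> real"
  proof -
    show m: "\<kappa> \<in> borel_measurable lebesgue" using that by (simp add: admissible_kernel_def)
    have "\<bar>\<kappa> z\<bar> \<le> \<kappa>\<^sub>1" for z
      using that \<kappa>\<^sub>0 unfolding admissible_kernel_def abs_le_iff by (smt (verit))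
    then show "small_jumps (small_part \<alpha> \<kappa>)" by (rule small_part_small_jumps(1)[OF \<alpha> m])
  qed
  have sgn_le: "norm (sgn x) \<le> 1" for x :: 'a by (simp add: norm_sgn)
  show ?thesis
  proof (rule that)
    show "0 < A" using D(1) C I W by (auto simp: A_def intro!: add_nonneg_pos)
  next
    fix \<kappa> :: "'a \<Rightarrow> real" assume adm: "admissible_kernel \<kappa>\<^sub>0 \<kappa>\<^sub>1 \<kappa>"
    note [measurable] = tilted_symbol_measurable[OF sj(2)[OF adm]]
    have eq: "small_char \<alpha> \<kappa> = (\<lambda>\<xi>. exp (- tilted_symbol (small_part \<alpha> \<kappa>) 0 0 \<xi>))"
      using small_char_conv_tilted[OF sj(2)[OF adm], of 0 0] by simp
    show "integrable lebesgue (small_char \<alpha> \<kappa>)"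
      unfolding eq
      by (rule integrable_dominated[OF int_w[of C]]) (measurable, rule decay1[OF adm], simp_all)
    fix x :: 'a
    have "cmod (fourier (small_char \<alpha> \<kappa>) x) \<le> exp (- norm x / 2) * (LINT \<xi>|lebesgue. C * ?w \<xi>)"
    proof (rule fourier_analytic_shift_bound)
      show "(\<lambda>s. exp (- tilted_symbol (small_part \<alpha> \<kappa>) (sgn x) s \<xi>)) holomorphic_on ball 0 1" for \<xi>
        by (intro holomorphic_intros tilted_symbol_holomorphic sj(2) adm sgn_le)
      show "exp (- tilted_symbol (small_part \<alpha> \<kappa>) (sgn x) (complex_of_real r) \<xi>) = small_char \<alpha> \<kappa> (\<xi> + r *\<^sub>R sgn x)"
        for r \<xi> by (rule small_char_conv_tilted[OF sj(2)[OF adm]])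
      show "cmod (exp (- tilted_symbol (small_part \<alpha> \<kappa>) (sgn x) s \<xi>)) \<le> C * ?w \<xi>" if "s \<in> ball 0 1" for s \<xi>
        by (rule decay1[OF adm sgn_le that])
    qed (measurable, rule int_w)
    also have "\<dots> \<le> (D * ?w x) * (C * W)"
      unfolding integral_mult_right_zero W_def[symmetric]
      using C W exp_le[of x] by (intro mult_right_mono) auto
    also have "\<dots> = (D * (C * W)) * ?w x" by simp
    also have "\<dots> \<le> A * ?w x"
      using D(1) C I W by (intro mult_right_mono) (auto simp: A_def)
    finally show "cmod (fourier (small_char \<alpha> \<kappa>) x) \<le> A * ?w x" .
  next
    fix \<kappa> \<kappa>' :: "'a \<Rightarrow> real" and \<delta> :: real and x :: 'a
    assume adm: "admissible_kernel \<kappa>\<^sub>0 \<kappa>\<^sub>1 \<kappa>" "admissible_kernel \<kappa>\<^sub>0 \<kappa>\<^sub>1 \<kappa>'"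
      and \<delta>: "\<And>z. \<bar>\<kappa> z - \<kappa>' z\<bar> \<le> \<delta>"
    have \<delta>0: "0 \<le> \<delta>" using \<delta>[of 0] by linarith
    have [measurable]: "\<kappa> \<in> borel_measurable lebesgue" "\<kappa>' \<in> borel_measurable lebesgue"
      using adm sj(1) by blast+
    note [measurable] = tilted_symbol_measurable[OF sj(2)[OF adm(1)]] tilted_symbol_measurable[OF sj(2)[OF adm(2)]]
    let ?T = "tilted_symbol (small_part \<alpha> \<kappa>) (sgn x)" and ?T' = "tilted_symbol (small_part \<alpha> \<kappa>') (sgn x)"
    have md: "(\<lambda>z. \<kappa> z - \<kappa>' z) \<in> borel_measurable lebesgue" by measurable
    note diff = small_part_small_jumps[OF \<alpha> md \<delta>]
    have "cmod (fourier (\<lambda>\<xi>. small_char \<alpha> \<kappa> \<xi> - small_char \<alpha> \<kappa>' \<xi>) x) \<le> 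
      exp (- norm x / 2) * (LINT \<xi>|lebesgue. (2 * (\<delta> * I) * C) * ?w \<xi>)"
    proof (rule fourier_analytic_shift_bound)
      show "(\<lambda>s. exp (- ?T s \<xi>) - exp (- ?T' s \<xi>)) holomorphic_on ball 0 1" for \<xi>
        by (intro holomorphic_intros tilted_symbol_holomorphic sj(2) adm sgn_le)
      show "exp (- ?T (complex_of_real r) \<xi>) - exp (- ?T' (complex_of_real r) \<xi>) = 
          small_char \<alpha> \<kappa> (\<xi> + r *\<^sub>R sgn x) - small_char \<alpha> \<kappa>' (\<xi> + r *\<^sub>R sgn x)" for r \<xi>
        by (simp only: small_char_conv_tilted sj(2) adm)
      show "cmod (exp (- ?T s \<xi>) - exp (- ?T' s \<xi>)) \<le> (2 * (\<delta> * I) * C) * ?w \<xi>" if s: "s \<in> ball 0 1" for s \<xi>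
      proof -
        let ?q = "(1 + norm \<xi>)\<^sup>2"
        have "0 < 1 + norm \<xi>" using norm_ge_zero[of \<xi>] by linarith
        then have q: "0 < ?q" by simp
        have "cmod (exp (- ?T s \<xi>) - exp (- ?T' s \<xi>)) \<le> C * ?w \<xi> / ?q * cmod (- ?T s \<xi> - - ?T' s \<xi>)"
          by (rule norm_exp_diff_le)
            (use decay[OF adm(1) sgn_le s, of \<xi>] decay[OF adm(2) sgn_le s, of \<xi>] q in
              \<open>simp_all only: pos_le_divide_eq mult.commute\<close>)
        also have "cmod (- ?T s \<xi> - - ?T' s \<xi>) = cmod (?T s \<xi> - ?T' s \<xi>)"
          by (simp add: norm_minus_commute)
        also have "?T s \<xi> - ?T' s \<xi> = tilted_symbol (small_part \<alpha> (\<lambda>z. \<kappa> z - \<kappa>' z)) (sgn x) s \<xi>"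
          unfolding small_part_diff by (rule tilted_symbol_diff[symmetric]) (intro sj(2) adm sgn_le s)+
        also have "C * ?w \<xi> / ?q * cmod \<dots> \<le> C * ?w \<xi> / ?q * (2 * ?q * (\<delta> * I))"
        proof (rule mult_left_mono)
          have "cmod (tilted_symbol (small_part \<alpha> (\<lambda>z. \<kappa> z - \<kappa>' z)) (sgn x) s \<xi>) \<le> 
            2 * ?q * second_moment (small_part \<alpha> (\<lambda>z. \<kappa> z - \<kappa>' z))"
            by (rule norm_tilted_symbol_le[OF diff(1) sgn_le s])
          also have "\<dots> \<le> 2 * ?q * (\<delta> * I)"
            unfolding I_def by (rule mult_left_mono[OF diff(2)]) simp
          finally show "cmod (tilted_symbol (small_part \<alpha> (\<lambda>z. \<kappa> z - \<kappa>' z)) (sgn x) s \<xi>) \<le> 2 * ?q * (\<delta> * I)" .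
          show "0 \<le> C * ?w \<xi> / ?q" using C by simp
        qed
        also have "\<dots> = (2 * (\<delta> * I) * C) * ?w \<xi>"
          using q by simp
        finally show ?thesis .
      qed
    qed (measurable, rule int_w)
    also have "\<dots> = exp (- norm x / 2) * ((2 * (\<delta> * I) * C) * W)"
      by (simp add: W_def)
    also have "\<dots> \<le> (D * ?w x) * ((2 * (\<delta> * I) * C) * W)"
      using C W I \<delta>0 exp_le[of x] by (intro mult_right_mono) auto
    also have "\<dots> = (D * (2 * I * C * W) * \<delta>) * ?w x" by simp
    also have "\<dots> \<le> (A * \<delta>) * ?w x"
      using D(1) C I W \<delta>0 by (intro mult_right_mono) (auto simp: A_def)
    finally show "cmod (fourier (\<lambda>\<xi>. small_char \<alpha> \<kappa> \<xi> - small_char \<alpha> \<kappa>' \<xi>) x) \<le> (A * \<delta>) * ?w x" .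
  qed
qed

definition full_char :: "real \<Rightarrow> ('a::euclidean_space \<Rightarrow> real) \<Rightarrow> 'a \<Rightarrow> complex" where
  "full_char \<alpha> \<kappa> \<xi> = complex_of_real (exp (- levy_symbol \<alpha> \<kappa> \<xi>))"

text \<open>
  The characteristic function is the product of the parts for small and for large jumps. The
  difference of two such products splits into a change of the small jumps, multiplied by the compound
  Poisson factor of \<open>\<kappa>\<close>, and the full kernel of \<open>\<kappa>'\<close> multiplied by the factor \<open>exp (- \<dots>) - 1\<close> belonging to
  the difference of the large jumps. Both terms are of order \<open>\<delta>\<close>.
\<close>

lemma unit_time_bound:
  fixes \<alpha> \<kappa>\<^sub>0 \<kappa>\<^sub>1 :: real
  assumes \<alpha>: "0 < \<alpha>" "\<alpha> < 2" and \<kappa>\<^sub>0: "0 < \<kappa>\<^sub>0" and \<kappa>\<^sub>1: "0 \<le> \<kappa>\<^sub>1"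
  obtains c where "0 < c"
    "\<And>(\<kappa> :: 'a::euclidean_space \<Rightarrow> real) \<kappa>' \<delta> x. admissible_kernel \<kappa>\<^sub>0 \<kappa>\<^sub>1 \<kappa> \<Longrightarrow> admissible_kernel \<kappa>\<^sub>0 \<kappa>\<^sub>1 \<kappa>' \<Longrightarrow>
      (\<And>z. \<bar>\<kappa> z - \<kappa>' z\<bar> \<le> \<delta>) \<Longrightarrow> \<delta> \<le> \<kappa>\<^sub>1 \<Longrightarrow>
      cmod (fourier (full_char \<alpha> \<kappa>) x - fourier (full_char \<alpha> \<kappa>') x) \<le> c * \<delta> * tail_weight \<alpha> x"
proof -
  let ?w = "tail_weight \<alpha> :: 'a \<Rightarrow> real"
  obtain A where A: "0 < A"
    and int: "\<And>\<kappa> :: 'a \<Rightarrow> real. admissible_kernel \<kappa>\<^sub>0 \<kappa>\<^sub>1 \<kappa> \<Longrightarrow> integrable lebesgue (small_char \<alpha> \<kappa>)"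
    and one: "\<And>(\<kappa> :: 'a \<Rightarrow> real) x. admissible_kernel \<kappa>\<^sub>0 \<kappa>\<^sub>1 \<kappa> \<Longrightarrow> cmod (fourier (small_char \<alpha> \<kappa>) x) \<le> A * ?w x"
    and two: "\<And>(\<kappa> :: 'a \<Rightarrow> real) \<kappa>' \<delta> x. admissible_kernel \<kappa>\<^sub>0 \<kappa>\<^sub>1 \<kappa> \<Longrightarrow> admissible_kernel \<kappa>\<^sub>0 \<kappa>\<^sub>1 \<kappa>' \<Longrightarrow> 
      (\<And>z. \<bar>\<kappa> z - \<kappa>' z\<bar> \<le> \<delta>) \<Longrightarrow> 
      cmod (fourier (\<lambda>\<xi>. small_char \<alpha> \<kappa> \<xi> - small_char \<alpha> \<kappa>' \<xi>) x) \<le> (A * \<delta>) * ?w x"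
    using small_kernel_bounds[OF assms, where 'a='a] by blast
  define L where "L = 2 powr (real DIM('a) + \<alpha>) * jump_const TYPE('a) \<alpha>"
  have L: "0 \<le> L" using jump_const_nonneg[where 'a='a and a=\<alpha>] by (simp add: L_def)
  define E where "E = exp (\<kappa>\<^sub>1 * L)"
  show ?thesis
  proof (rule that)
    show "0 < A * E * (1 + L * E)" using A L by (auto simp: E_def intro!: mult_pos_pos add_pos_nonneg)
    fix \<kappa> \<kappa>' :: "'a \<Rightarrow> real" and \<delta> :: real and x :: 'a
    assume adm: "admissible_kernel \<kappa>\<^sub>0 \<kappa>\<^sub>1 \<kappa>" "admissible_kernel \<kappa>\<^sub>0 \<kappa>\<^sub>1 \<kappa>'"
      and \<delta>: "\<And>z. \<bar>\<kappa> z - \<kappa>' z\<bar> \<le> \<delta>" and \<delta>_le: "\<delta> \<le> \<kappa>\<^sub>1"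
    have \<delta>0: "0 \<le> \<delta>" using \<delta>[of 0] by linarith
    have meas: "\<kappa> \<in> borel_measurable lebesgue" "\<kappa>' \<in> borel_measurable lebesgue"
      using adm by (auto simp: admissible_kernel_def)
    have bd: "\<bar>\<kappa> z\<bar> \<le> \<kappa>\<^sub>1" "\<bar>\<kappa>' z\<bar> \<le> \<kappa>\<^sub>1" for z
      using adm \<kappa>\<^sub>0 unfolding admissible_kernel_def abs_le_iff by (smt (verit))+
    have md: "(\<lambda>z. \<kappa> z - \<kappa>' z) \<in> borel_measurable lebesgue" using meas by measurable
    let ?m = "large_part \<alpha> \<kappa>" and ?m' = "large_part \<alpha> \<kappa>'" and ?d = "large_part \<alpha> (\<lambda>z. \<kappa> z - \<kappa>' z)"
    note m = large_part_bound[OF \<alpha>(1) meas(1) bd(1)]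
    note m' = large_part_bound[OF \<alpha>(1) meas(2) bd(2)]
    note d = large_part_bound[OF \<alpha>(1) md \<delta>]
    have jd: "jump_symbol ?d \<xi> = jump_symbol ?m \<xi> - jump_symbol ?m' \<xi>" for \<xi>
      unfolding large_part_diff jump_symbol_def
      using integrable_jump_symbol_integrand[OF m(2), of \<xi>] integrable_jump_symbol_integrand[OF m'(2), of \<xi>]
      by (simp add: right_diff_distrib)
    let ?\<Delta> = "\<lambda>\<xi>. small_char \<alpha> \<kappa> \<xi> - small_char \<alpha> \<kappa>' \<xi>"
    define \<Psi> where "\<Psi> \<xi> = complex_of_real (exp (- jump_symbol ?m' \<xi>)) * small_char \<alpha> \<kappa>' \<xi>" for \<xi>
    have full: "full_char \<alpha> \<kappa> \<xi> = complex_of_real (exp (- jump_symbol ?m \<xi>)) * small_char \<alpha> \<kappa> \<xi>" 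
      "full_char \<alpha> \<kappa>' \<xi> = \<Psi> \<xi>" for \<xi>
      unfolding full_char_def small_char_def \<Psi>_def
        levy_symbol_split[OF \<alpha> meas(1) bd(1)] levy_symbol_split[OF \<alpha> meas(2) bd(2)]
      by (simp_all add: exp_add exp_diff exp_minus divide_inverse)
    have \<Psi>: "integrable lebesgue \<Psi>" "cmod (fourier \<Psi> y) \<le> (A * E) * ?w y" for y
      unfolding \<Psi>_def[abs_def] E_def L_def
      using fourier_exp_jump_symbol_bound[OF \<alpha>(1) int[OF adm(2)] m'(2) one[OF adm(2)] m'(1)]
      by (simp_all add: mult.assoc)
    have \<Delta>: "integrable lebesgue ?\<Delta>"
      by (intro Bochner_Integration.integrable_diff int adm)
    have intf: "integrable lebesgue (full_char \<alpha> \<kappa>)"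
      unfolding full(1)[abs_def]
      by (rule fourier_exp_jump_symbol_bound(1)[OF \<alpha>(1) int[OF adm(1)] m(2) one[OF adm(1)] m(1)])
    note e1 = fourier_exp_jump_symbol_bound[OF \<alpha>(1) \<Delta> m(2) two[OF adm \<delta>] m(1)]
    note e2 = fourier_exp_jump_symbol_minus_one_bound[OF \<alpha>(1) \<Psi>(1) d(2) \<Psi>(2) d(1)]
    have split: "full_char \<alpha> \<kappa> \<xi> - full_char \<alpha> \<kappa>' \<xi> = complex_of_real (exp (- jump_symbol ?m \<xi>)) * ?\<Delta> \<xi> +
       complex_of_real (exp (- jump_symbol ?d \<xi>) - 1) * \<Psi> \<xi>" for \<xi>
    proof -
      have "complex_of_real (exp (- jump_symbol ?d \<xi>)) * complex_of_real (exp (- jump_symbol ?m' \<xi>)) =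
         complex_of_real (exp (- jump_symbol ?m \<xi>))"
        unfolding jd of_real_mult[symmetric] exp_add[symmetric] by simp
      then show ?thesis
        unfolding full \<Psi>_def of_real_diff by (simp add: algebra_simps del: of_real_exp)
    qed
    have "fourier (full_char \<alpha> \<kappa>) x - fourier (full_char \<alpha> \<kappa>') x = 
       fourier (\<lambda>\<xi>. full_char \<alpha> \<kappa> \<xi> - full_char \<alpha> \<kappa>' \<xi>) x"
      using fourier_diff[OF intf \<Psi>(1), of x] full(2) by (simp add: ext[of "full_char \<alpha> \<kappa>'" \<Psi>])
    also have "\<dots> = fourier (\<lambda>\<xi>. complex_of_real (exp (- jump_symbol ?m \<xi>)) * ?\<Delta> \<xi>) x +
       fourier (\<lambda>\<xi>. complex_of_real (exp (- jump_symbol ?d \<xi>) - 1) * \<Psi> \<xi>) x"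
      unfolding split by (rule fourier_add[OF e1(1) e2(1)])
    also have "cmod \<dots> \<le> A * \<delta> * E * ?w x + (A * E) * (exp (\<delta> * L) - 1) * ?w x"
      using norm_triangle_mono[OF e1(2) e2(2), of x x] by (simp add: E_def L_def mult.assoc)
    also have "\<dots> \<le> A * \<delta> * E * ?w x + (A * E) * (\<delta> * L * E) * ?w x"
    proof -
      \<comment> \<open>Convexity: \<open>exp y - 1 \<le> y * exp y\<close>.\<close>
      have "exp (\<delta> * L) * (1 - \<delta> * L) \<le> exp (\<delta> * L) * exp (- (\<delta> * L))"
        using exp_ge_add_one_self[of "- (\<delta> * L)"] by (intro mult_left_mono) auto
      then have "exp (\<delta> * L) - 1 \<le> \<delta> * L * exp (\<delta> * L)"
        by (simp add: exp_minus algebra_simps)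
      also have "\<dots> \<le> \<delta> * L * E"
        unfolding E_def using \<delta>0 \<delta>_le L by (intro mult_left_mono) (auto intro: mult_right_mono)
      finally show ?thesis
        using A by (intro add_left_mono mult_right_mono mult_left_mono) (auto simp: E_def)
    qed
    also have "\<dots> = A * E * (1 + L * E) * \<delta> * ?w x"
      by (simp add: algebra_simps)
    finally show "cmod (fourier (full_char \<alpha> \<kappa>) x - fourier (full_char \<alpha> \<kappa>') x) \<le> A * E * (1 + L * E) * \<delta> * ?w x" .
  qed
qed

section \<open>Scaling and the theorem\<close>

text \<open>
  Dilating the kernel amounts to dilating the frequency, because the density \<open>norm z powr - (d + \<alpha>)\<close>
  is homogeneous. Dilation preserves the bounds on the kernel, so every time can be reduced to time 1
  with a constant that does not depend on the time.
\<close>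

lemma levy_symbol_scaling:
  fixes \<kappa> :: "'a::euclidean_space \<Rightarrow> real"
  assumes [measurable]: "\<kappa> \<in> borel_measurable lebesgue" and \<rho>: "0 < \<rho>"
  shows "levy_symbol \<alpha> (\<lambda>z. \<kappa> (\<rho> *\<^sub>R z)) \<xi> = \<rho> powr \<alpha> * levy_symbol \<alpha> \<kappa> ((1 / \<rho>) *\<^sub>R \<xi>)"
proof -
  let ?p = "real DIM('a) + \<alpha>"
  let ?f = "\<lambda>y. (1 - cos (((1 / \<rho>) *\<^sub>R \<xi>) \<bullet> y)) * levy_density \<alpha> \<kappa> y"
  have f: "?f \<in> borel_measurable lebesgue" by measurable
  have "(1 - cos (\<xi> \<bullet> z)) * levy_density \<alpha> (\<lambda>z. \<kappa> (\<rho> *\<^sub>R z)) z = \<rho> powr ?p * ?f (0 + \<rho> *\<^sub>R z)" for z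
    using \<rho> by (simp add: levy_density_def powr_mult)
  then have "levy_symbol \<alpha> (\<lambda>z. \<kappa> (\<rho> *\<^sub>R z)) \<xi> = \<rho> powr ?p * (LINT z|lebesgue. ?f (0 + \<rho> *\<^sub>R z))"
    unfolding levy_symbol_def by (simp only: integral_mult_right_zero)
  also have "(LINT z|lebesgue. ?f (0 + \<rho> *\<^sub>R z)) = (1 / \<rho> ^ DIM('a)) * levy_symbol \<alpha> \<kappa> ((1 / \<rho>) *\<^sub>R \<xi>)"
    using lebesgue_integral_affine[OF f, of \<rho> 0] \<rho> by (simp add: levy_symbol_def)
  finally show ?thesis
    using \<rho> by (simp add: powr_add powr_realpow)
qed

lemma heat_kernel_scaling:
  fixes \<kappa> :: "'a::euclidean_space \<Rightarrow> real"
  assumes [measurable]: "\<kappa> \<in> borel_measurable lebesgue" and \<rho>: "0 < \<rho>" and t: "t = \<rho> powr \<alpha>"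
  shows "heat_kernel \<alpha> \<kappa> t x = complex_of_real (1 / (2 * pi) ^ DIM('a) / \<rho> ^ DIM('a)) *
    fourier (full_char \<alpha> (\<lambda>z. \<kappa> (\<rho> *\<^sub>R z))) ((1 / \<rho>) *\<^sub>R x)"
proof -
  let ?g = "\<lambda>\<xi>. exp (- \<i> * complex_of_real (x \<bullet> \<xi>)) * complex_of_real (exp (- t * levy_symbol \<alpha> \<kappa> \<xi>))"
  have "levy_symbol \<alpha> \<kappa> = jump_symbol (levy_density \<alpha> \<kappa>)"
    by (simp add: fun_eq_iff levy_symbol_def jump_symbol_def)
  then have [measurable]: "levy_symbol \<alpha> \<kappa> \<in> borel_measurable lebesgue" by simp
  have g: "?g \<in> borel_measurable lebesgue" by measurable
  have "fourier (full_char \<alpha> (\<lambda>z. \<kappa> (\<rho> *\<^sub>R z))) ((1 / \<rho>) *\<^sub>R x) = (LINT \<xi>|lebesgue. ?g (0 + (1 / \<rho>) *\<^sub>R \<xi>))"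
    unfolding fourier_def full_char_def levy_symbol_scaling[OF assms(1) \<rho>] t by simp
  also have "\<dots> = complex_of_real (\<rho> ^ DIM('a)) * (LINT \<xi>|lebesgue. ?g \<xi>)"
    using lebesgue_integral_affine[OF g, of "1 / \<rho>" 0] \<rho> by (simp add: scaleR_conv_of_real power_divide)
  finally show ?thesis
    using \<rho> by (simp add: heat_kernel_def)
qed

theorem mainTheorem1:
  fixes \<alpha> \<kappa>\<^sub>0 \<kappa>\<^sub>1 :: real
  assumes "0 < \<alpha>" and "\<alpha> < 2"
    and "0 < \<kappa>\<^sub>0" and "\<kappa>\<^sub>0 \<le> \<kappa>\<^sub>1"
  shows "\<exists>c>0. \<forall>\<kappa> \<kappa>' :: 'a::euclidean_space \<Rightarrow> real.
           admissible_kernel \<kappa>\<^sub>0 \<kappa>\<^sub>1 \<kappa> \<longrightarrow> admissible_kernel \<kappa>\<^sub>0 \<kappa>\<^sub>1 \<kappa>' \<longrightarrow>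
           (\<forall>t x. 0 < t \<and> t \<le> 1 \<longrightarrow>
              cmod (heat_kernel \<alpha> \<kappa> t x - heat_kernel \<alpha> \<kappa>' t x)
                \<le> c * sup_norm (\<lambda>z. \<kappa> z - \<kappa>' z) *
                   (t / (t powr (1 / \<alpha>) + norm x) powr (real DIM('a) + \<alpha>)))"
proof -
  let ?p = "real DIM('a) + \<alpha>"
  have "0 \<le> \<kappa>\<^sub>1" using assms by linarith
  with assms(1-3) obtain c where c: "0 < c" and unit:
    "\<And>(\<kappa> :: 'a \<Rightarrow> real) \<kappa>' \<delta> x. admissible_kernel \<kappa>\<^sub>0 \<kappa>\<^sub>1 \<kappa> \<Longrightarrow> admissible_kernel \<kappa>\<^sub>0 \<kappa>\<^sub>1 \<kappa>' \<Longrightarrow>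
      (\<And>z. \<bar>\<kappa> z - \<kappa>' z\<bar> \<le> \<delta>) \<Longrightarrow> \<delta> \<le> \<kappa>\<^sub>1 \<Longrightarrow>
      cmod (fourier (full_char \<alpha> \<kappa>) x - fourier (full_char \<alpha> \<kappa>') x) \<le> c * \<delta> * tail_weight \<alpha> x"
    using unit_time_bound[of \<alpha> \<kappa>\<^sub>0 \<kappa>\<^sub>1, where 'a='a] by blast
  define N where "N = 1 / (2 * pi) ^ DIM('a)"
  have N: "0 < N" by (simp add: N_def)
  show ?thesis
  proof (intro exI[of _ "N * c"] conjI allI impI)
    show "0 < N * c" using N c by simp
    fix \<kappa> \<kappa>' :: "'a \<Rightarrow> real" and t :: real and x :: 'a
    assume adm: "admissible_kernel \<kappa>\<^sub>0 \<kappa>\<^sub>1 \<kappa>" "admissible_kernel \<kappa>\<^sub>0 \<kappa>\<^sub>1 \<kappa>'" and t: "0 < t \<and> t \<le> 1"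
    have meas [measurable]: "\<kappa> \<in> borel_measurable lebesgue" "\<kappa>' \<in> borel_measurable lebesgue"
      using adm by (auto simp: admissible_kernel_def)
    define \<delta> where "\<delta> = sup_norm (\<lambda>z. \<kappa> z - \<kappa>' z)"
    have diff: "\<bar>\<kappa> z - \<kappa>' z\<bar> \<le> \<kappa>\<^sub>1" for z
    proof -
      have "\<kappa>\<^sub>0 \<le> \<kappa> z" "\<kappa> z \<le> \<kappa>\<^sub>1" "\<kappa>\<^sub>0 \<le> \<kappa>' z" "\<kappa>' z \<le> \<kappa>\<^sub>1"
        using adm by (auto simp: admissible_kernel_def)
      then show ?thesis using assms(3) by linarith
    qed
    have \<delta>: "\<bar>\<kappa> z - \<kappa>' z\<bar> \<le> \<delta>" for z
      unfolding \<delta>_def sup_norm_def by (rule cSUP_upper) (use diff in \<open>auto intro!: bdd_aboveI\<close>)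
    have \<delta>_le: "\<delta> \<le> \<kappa>\<^sub>1"
      unfolding \<delta>_def sup_norm_def by (rule cSUP_least) (use diff in auto)
    define \<rho> where "\<rho> = t powr (1 / \<alpha>)"
    have \<rho>: "0 < \<rho>" "t = \<rho> powr \<alpha>" using t assms(1) by (auto simp: \<rho>_def powr_powr)
    have scaled: "admissible_kernel \<kappa>\<^sub>0 \<kappa>\<^sub>1 (\<lambda>z. \<kappa> (\<rho> *\<^sub>R z))" "admissible_kernel \<kappa>\<^sub>0 \<kappa>\<^sub>1 (\<lambda>z. \<kappa>' (\<rho> *\<^sub>R z))"
      using adm measurable_compose[OF lebesgue_measurable_scaling[of \<rho>] meas(1)]
        measurable_compose[OF lebesgue_measurable_scaling[of \<rho>] meas(2)]
      by (auto simp: admissible_kernel_def)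
    let ?y = "(1 / \<rho>) *\<^sub>R x"
    have "heat_kernel \<alpha> \<kappa> t x - heat_kernel \<alpha> \<kappa>' t x = complex_of_real (N / \<rho> ^ DIM('a)) *
       (fourier (full_char \<alpha> (\<lambda>z. \<kappa> (\<rho> *\<^sub>R z))) ?y - fourier (full_char \<alpha> (\<lambda>z. \<kappa>' (\<rho> *\<^sub>R z))) ?y)"
      unfolding N_def heat_kernel_scaling[OF meas(1) \<rho>] heat_kernel_scaling[OF meas(2) \<rho>] by (simp only: right_diff_distrib)
    also have "cmod \<dots> = N / \<rho> ^ DIM('a) *
       cmod (fourier (full_char \<alpha> (\<lambda>z. \<kappa> (\<rho> *\<^sub>R z))) ?y - fourier (full_char \<alpha> (\<lambda>z. \<kappa>' (\<rho> *\<^sub>R z))) ?y)"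
      unfolding norm_mult norm_of_real using N \<rho> by simp
    also have "\<dots> \<le> N / \<rho> ^ DIM('a) * (c * \<delta> * tail_weight \<alpha> ?y)"
      using N \<rho> by (intro mult_left_mono unit scaled \<delta> \<delta>_le) auto
    also have "\<dots> = N * c * \<delta> * (t / (\<rho> + norm x) powr ?p)"
    proof -
      have y: "1 + norm ?y = (\<rho> + norm x) / \<rho>" using \<rho> by (simp add: field_simps)
      have "tail_weight \<alpha> ?y = \<rho> powr ?p / (\<rho> + norm x) powr ?p"
        using \<rho> unfolding tail_weight_def powr_minus y by (simp add: powr_divide)
      also have "\<rho> powr ?p = \<rho> ^ DIM('a) * t"
        using \<rho> by (simp add: powr_add powr_realpow)
      finally show ?thesis using \<rho>(1) by simp
    qed
    finally show "cmod (heat_kernel \<alpha> \<kappa> t x - heat_kernel \<alpha> \<kappa>' t x)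
       \<le> N * c * sup_norm (\<lambda>z. \<kappa> z - \<kappa>' z) * (t / (t powr (1 / \<alpha>) + norm x) powr ?p)"
      unfolding \<delta>_def \<rho>_def .
  qed
qed

end
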